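(* Let $B$ and $E$ be LD-spaces and let $p:E\to B$ be a Serre fibration. Let $b_0\in B$, $F=p^{-1}(b_0)$ and $e_0\in F$. Then the induced map $p_*:\pi_n(E,F,e_0)^{\mathcal{R}}\to\pi_n(B,b_0)^{\mathcal{R}}$ is a bijection for $n=1$ and an isomorphism for all $n\geq2$.
   Context: Fix an o-minimal expansion $\mathcal{R}$ of a real closed field $R$; "definable" means definable with parameters, and definable maps are continuous. $I=[0,1]\subseteq R$. A locally definable space is a set $M$ with an atlas $(M_i,\phi_i)$: $M=\bigcup M_i$, each $\phi_i:M_i\to Z_i$ is a bijection onto a definable $Z_i\subseteq R^{n(i)}$, each $\phi_i(M_i\cap M_j)$ is relatively open definable in $Z_i$, and the transitions are definable. It has the topology making charts open homeomorphisms. An ld-space is a Hausdorff such space. A definable subspace lies in finitely many charts with definable images; $Y$ is admissible if its image in every chart is definable. An ld-map $f:M\to N$ is a map such that each $f(M_i)$ is a definable subspace and $f|_{M_i}$ is definable. $M$ is regular if points have fundamental systems of closed neighbourhoods, and paracompact if there is a locally finite covering (each chart meets finitely many members) by open definable subspaces. An LD-space is a regular paracompact ld-space. An ld-map $p:E\to B$ is a Serre fibration if for every closed and bounded definable set $X$ (in some $R^m$), every ld-map $f:X\to E$ and every ld-homotopy $H:X\times I\to B$ with $H(\cdot,0)=p\circ f$, there is an ld-homotopy $\widetilde{H}:X\times I\to E$ with $p\circ\widetilde{H}=H$ and $\widetilde{H}(\cdot,0)=f$. For a pointed pair $(X,A,x_0)$ (with $A$ admissible and $x_0\in A$), $\pi_n(X,A,x_0)^{\mathcal{R}}$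 is the set of ld-maps $(I^n,I^{n-1},J^{n-1})\to(X,A,x_0)$ modulo ld-homotopy of such maps, where $I^{n-1}=\{t\in I^n:t_n=0\}$ and $J^{n-1}=\overline{\partial I^n\setminus I^{n-1}}$. It carries the usual group structure for $n\geq2$. $\pi_n(B,b_0)^{\mathcal{R}}$ is the group of ld-maps $(I^n,\partial I^n)\to(B,b_0)$ modulo ld-homotopy relative to $\partial I^n$. *)

theory Defs
  imports "HOL-Analysis.Analysis" "HOL-Algebra.Group"
begin

class real_closed_field = linordered_field +
  assumes nonneg_has_sqrt: "0 \<le> a \<Longrightarrow> \<exists>b. b * b = a"
    and odd_degree_has_root: "odd n \<Longrightarrow> q n \<noteq> 0 \<Longrightarrow> \<exists>x. (\<Sum>i\<le>n. q i * x ^ i) = 0"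


subsection \<open>The spaces \<open>R\<^sup>n\<close>\<close>

text \<open>Points of \<open>R\<^sup>n\<close> are lists of length \<open>n\<close>, so that \<open>R\<^sup>m \<times> R\<^sup>n\<close> is identified with
  \<open>R\<^sup>m\<^sup>+\<^sup>n\<close> by \<open>@\<close>.\<close>

definition Rn :: "nat \<Rightarrow> 'r list set" where
  "Rn n = {x. length x = n}"

text \<open>The product of the order topologies, given by open boxes.\<close>

definition Rn_open :: "nat \<Rightarrow> 'r::linordered_field list set \<Rightarrow> bool" where
  "Rn_open n U \<longleftrightarrow> U \<subseteq> Rn n \<and>
     (\<forall>x\<in>U. \<exists>e>0. \<forall>y\<in>Rn n. (\<forall>i<n. \<bar>y ! i - x ! i\<bar> < e) \<longrightarrow> y \<in> U)"

definition Rn_top :: "nat \<Rightarrow> 'r::linordered_field list topology" where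
  "Rn_top n = topology (Rn_open n)"

lemma istopology_Rn_open: "istopology (Rn_open n)"
  unfolding istopology_def
proof (intro conjI allI impI)
  fix S T :: "'a list set"
  assume S: "Rn_open n S" and T: "Rn_open n T"
  show "Rn_open n (S \<inter> T)"
    unfolding Rn_open_def
  proof (intro conjI ballI)
    show "S \<inter> T \<subseteq> Rn n" using S by (auto simp: Rn_open_def)
  next
    fix x assume x: "x \<in> S \<inter> T"
    obtain d where d: "d > 0" "\<forall>y\<in>Rn n. (\<forall>i<n. \<bar>y ! i - x ! i\<bar> < d) \<longrightarrow> y \<in> S"
      using S x unfolding Rn_open_def by blast
    obtain e where e: "e > 0" "\<forall>y\<in>Rn n. (\<forall>i<n. \<bar>y ! i - x ! i\<bar> < e) \<longrightarrow> y \<in> T"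
      using T x unfolding Rn_open_def by blast
    show "\<exists>e>0. \<forall>y\<in>Rn n. (\<forall>i<n. \<bar>y ! i - x ! i\<bar> < e) \<longrightarrow> y \<in> S \<inter> T"
      using d e by (intro exI[of _ "min d e"]) auto
  qed
next
  fix K :: "'a list set set"
  assume "\<forall>S\<in>K. Rn_open n S"
  then show "Rn_open n (\<Union>K)"
    unfolding Rn_open_def by (fastforce dest: bspec)
qed

lemma openin_Rn_top: "openin (Rn_top n) U \<longleftrightarrow> Rn_open n U"
  by (simp add: Rn_top_def topology_inverse' istopology_Rn_open)

lemma topspace_Rn_top [simp]: "topspace (Rn_top n) = (Rn n :: 'r::linordered_field list set)"
proof -
  have "Rn_open n (Rn n :: 'r list set)"
    unfolding Rn_open_def by (auto intro: zero_less_one)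
  then show ?thesis
    by (metis Rn_open_def openin_Rn_top openin_subset openin_topspace subset_antisym)
qed


subsection \<open>O-minimal expansions\<close>

definition basic_interval :: "'r::linordered_field set \<Rightarrow> bool" where
  "basic_interval S \<longleftrightarrow> S = UNIV \<or>
     (\<exists>a b. S = {a} \<or> S = {a<..<b} \<or> S = {..<b} \<or> S = {a<..})"

text \<open>An expansion is given by its sets definable with parameters: \<open>D n\<close> consists of the
  definable subsets of \<open>R\<^sup>n\<close>.  The families arising in this way are exactly those closed under the
  first-order operations (van den Dries' notion of a structure) that contain the singletons, the
  order and the graphs of the field operations.\<close>

locale ominimal_expansion =
  fixes D :: "nat \<Rightarrow> 'r::real_closed_field list set set"
  assumes definable_subset: "A \<in> D n \<Longrightarrow> A \<subseteq> Rn n"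
    and definable_empty: "{} \<in> D n"
    and definable_Un: "A \<in> D n \<Longrightarrow> A' \<in> D n \<Longrightarrow> A \<union> A' \<in> D n"
    and definable_compl: "A \<in> D n \<Longrightarrow> Rn n - A \<in> D n"
    and definable_prod: "A \<in> D m \<Longrightarrow> A' \<in> D n \<Longrightarrow> {x @ y |x y. x \<in> A \<and> y \<in> A'} \<in> D (m + n)"
    and definable_diagonal: "i < n \<Longrightarrow> j < n \<Longrightarrow> {x \<in> Rn n. x ! i = x ! j} \<in> D n"
    and definable_projection: "A \<in> D (Suc n) \<Longrightarrow> butlast ` A \<in> D n"
    and definable_singleton: "{[a]} \<in> D 1"
    and definable_less: "{[x, y] |x y. x < y} \<in> D 2"
    and definable_add: "{[x, y, x + y] |x y. True} \<in> D 3"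
    and definable_mult: "{[x, y, x * y] |x y. True} \<in> D 3"
    and ominimal: "A \<in> D 1 \<Longrightarrow>
      \<exists>\<S>. finite \<S> \<and> (\<forall>S\<in>\<S>. basic_interval S) \<and> A = (\<lambda>x. [x]) ` \<Union>\<S>"

definition definable_map ::
  "(nat \<Rightarrow> 'r::real_closed_field list set set) \<Rightarrow> nat \<Rightarrow> 'r list set \<Rightarrow> nat \<Rightarrow> 'r list set \<Rightarrow>
    ('r list \<Rightarrow> 'r list) \<Rightarrow> bool" where
  "definable_map D m X n Y f \<longleftrightarrow>
     X \<in> D m \<and> Y \<in> D n \<and> {x @ f x |x. x \<in> X} \<in> D (m + n) \<and>
     continuous_map (subtopology (Rn_top m) X) (subtopology (Rn_top n) Y) f"


subsection \<open>Locally definable spaces\<close>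

text \<open>A space is represented by its atlas.  In a chart, \<open>cmap\<close> is only relevant on \<open>cdom\<close>.\<close>

datatype ('a, 'r) chart =
  Chart (cdom: "'a set") (cdim: nat) (cmap: "'a \<Rightarrow> 'r list")

definition cimg :: "('a, 'r) chart \<Rightarrow> 'r list set" where
  "cimg c = cmap c ` cdom c"

definition points :: "('a, 'r) chart set \<Rightarrow> 'a set" where
  "points M = (\<Union>c\<in>M. cdom c)"

definition locally_definable_space ::
  "(nat \<Rightarrow> 'r::real_closed_field list set set) \<Rightarrow> ('a, 'r) chart set \<Rightarrow> bool" where
  "locally_definable_space D M \<longleftrightarrow>
     (\<forall>c\<in>M. inj_on (cmap c) (cdom c) \<and> cimg c \<in> D (cdim c)) \<and>
     (\<forall>c\<in>M. \<forall>d\<in>M.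
        cmap c ` (cdom c \<inter> cdom d) \<in> D (cdim c) \<and>
        openin (subtopology (Rn_top (cdim c)) (cimg c)) (cmap c ` (cdom c \<inter> cdom d)) \<and>
        definable_map D (cdim c) (cmap c ` (cdom c \<inter> cdom d))
                        (cdim d) (cmap d ` (cdom c \<inter> cdom d))
                        (cmap d \<circ> inv_into (cdom c) (cmap c)))"

text \<open>A set is open iff its trace on every chart domain is the preimage of an open set under the
  chart.  The lemmas \<open>openin_cdom\<close> and \<open>chart_homeomorphic_map\<close> below confirm that this is the
  topology making the charts open homeomorphisms.\<close>

definition ld_open :: "('a, 'r::linordered_field) chart set \<Rightarrow> 'a set \<Rightarrow> bool" where
  "ld_open M U \<longleftrightarrow> U \<subseteq> points M \<and>
     (\<forall>c\<in>M. openin (pullback_topology (cdom c) (cmap c) (Rn_top (cdim c))) (U \<inter> cdom c))"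

definition ld_top :: "('a, 'r::linordered_field) chart set \<Rightarrow> 'a topology" where
  "ld_top M = topology (ld_open M)"

lemma istopology_ld_open: "istopology (ld_open M)"
  unfolding istopology_def
proof (intro conjI allI impI)
  fix S T
  assume S: "ld_open M S" and T: "ld_open M T"
  have eq: "S \<inter> T \<inter> cdom c = (S \<inter> cdom c) \<inter> (T \<inter> cdom c)" for c :: "('a, 'b) chart"
    by blast
  show "ld_open M (S \<inter> T)"
    using S T unfolding ld_open_def eq by auto
next
  fix K
  assume K: "\<forall>S\<in>K. ld_open M S"
  have eq: "\<Union>K \<inter> cdom c = (\<Union>S\<in>K. S \<inter> cdom c)" for c :: "('a, 'b) chart"
    by blast
  show "ld_open M (\<Union>K)"
    unfolding ld_open_def eq
  proof (intro conjI ballI)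
    show "\<Union>K \<subseteq> points M" using K unfolding ld_open_def by blast
  next
    fix c assume "c \<in> M"
    then show "openin (pullback_topology (cdom c) (cmap c) (Rn_top (cdim c))) (\<Union>S\<in>K. S \<inter> cdom c)"
      using K unfolding ld_open_def by (intro openin_Union) blast
  qed
qed

lemma openin_ld_top: "openin (ld_top M) U \<longleftrightarrow> ld_open M U"
  by (simp add: ld_top_def topology_inverse' istopology_ld_open)

definition ld_space ::
  "(nat \<Rightarrow> 'r::real_closed_field list set set) \<Rightarrow> ('a, 'r) chart set \<Rightarrow> bool" where
  "ld_space D M \<longleftrightarrow> locally_definable_space D M \<and> Hausdorff_space (ld_top M)"

definition definable_subspace ::
  "(nat \<Rightarrow> 'r::real_closed_field list set set) \<Rightarrow> ('a, 'r) chart set \<Rightarrow> 'a set \<Rightarrow> bool" where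
  "definable_subspace D M S \<longleftrightarrow>
     (\<exists>C. finite C \<and> C \<subseteq> M \<and> S \<subseteq> points C \<and>
          (\<forall>c\<in>C. cmap c ` (S \<inter> cdom c) \<in> D (cdim c)))"

definition admissible_subspace ::
  "(nat \<Rightarrow> 'r::real_closed_field list set set) \<Rightarrow> ('a, 'r) chart set \<Rightarrow> 'a set \<Rightarrow> bool" where
  "admissible_subspace D M Y \<longleftrightarrow>
     Y \<subseteq> points M \<and> (\<forall>c\<in>M. cmap c ` (Y \<inter> cdom c) \<in> D (cdim c))"

definition ld_paracompact ::
  "(nat \<Rightarrow> 'r::real_closed_field list set set) \<Rightarrow> ('a, 'r) chart set \<Rightarrow> bool" where
  "ld_paracompact D M \<longleftrightarrow>
     (\<exists>\<U>. \<Union>\<U> = points M \<and>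
          (\<forall>U\<in>\<U>. openin (ld_top M) U \<and> definable_subspace D M U) \<and>
          (\<forall>c\<in>M. finite {U \<in> \<U>. U \<inter> cdom c \<noteq> {}}))"

definition LD_space ::
  "(nat \<Rightarrow> 'r::real_closed_field list set set) \<Rightarrow> ('a, 'r) chart set \<Rightarrow> bool" where
  "LD_space D M \<longleftrightarrow> ld_space D M \<and> neighbourhood_base_of (closedin (ld_top M)) (ld_top M) \<and>
     ld_paracompact D M"

text \<open>The last conjunct says that the graph of the restriction of \<open>f\<close> to the chart domain of \<open>c\<close> is
  definable, read in the charts of the product.\<close>

definition ld_map ::
  "(nat \<Rightarrow> 'r::real_closed_field list set set) \<Rightarrow> ('a, 'r) chart set \<Rightarrow> ('b, 'r) chart set \<Rightarrow>
    ('a \<Rightarrow> 'b) \<Rightarrow> bool" where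
  "ld_map D M N f \<longleftrightarrow>
     (\<forall>c\<in>M. definable_subspace D N (f ` cdom c) \<and>
            continuous_map (subtopology (ld_top M) (cdom c)) (ld_top N) f \<and>
            (\<forall>d\<in>N. {cmap c x @ cmap d (f x) |x. x \<in> cdom c \<and> f x \<in> cdom d}
                     \<in> D (cdim c + cdim d)))"

text \<open>A definable subset of \<open>R\<^sup>m\<close>, as a space with one chart.\<close>

definition def_space :: "nat \<Rightarrow> 'r list set \<Rightarrow> ('r list, 'r) chart set" where
  "def_space m X = {Chart X m id}"


subsection \<open>Charts are open homeomorphisms\<close>

lemma topspace_ld_top:
  assumes "locally_definable_space D M" "ominimal_expansion D"
  shows "topspace (ld_top M) = points M"
proof (rule subset_antisym)
  show "topspace (ld_top M) \<subseteq> points M"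
    using openin_topspace[of "ld_top M"] unfolding openin_ld_top ld_open_def by blast
  have "ld_open M (points M)"
    unfolding ld_open_def
  proof (intro conjI ballI)
    fix c assume c: "c \<in> M"
    then have "cmap c ` cdom c \<subseteq> Rn (cdim c)"
      using assms ominimal_expansion.definable_subset
      unfolding locally_definable_space_def cimg_def by blast
    then have "points M \<inter> cdom c = cmap c -` topspace (Rn_top (cdim c)) \<inter> cdom c"
      using c unfolding points_def by auto
    then show "openin (pullback_topology (cdom c) (cmap c) (Rn_top (cdim c))) (points M \<inter> cdom c)"
      unfolding openin_pullback_topology by blast
  qed simp
  then show "points M \<subseteq> topspace (ld_top M)"
    by (metis openin_ld_top openin_subset)
qed

lemma chart_preimage_open:
  assumes M: "locally_definable_space D M" and "ominimal_expansion D"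
    and c: "c \<in> M" and V: "openin (Rn_top (cdim c)) V"
  shows "openin (ld_top M) (cmap c -` V \<inter> cdom c)"
  unfolding openin_ld_top ld_open_def
proof (intro conjI ballI)
  show "cmap c -` V \<inter> cdom c \<subseteq> points M" using c unfolding points_def by blast
next
  fix d assume d: "d \<in> M"
  let ?I = "cdom d \<inter> cdom c"
  let ?g = "cmap c \<circ> inv_into (cdom d) (cmap d)"
  have inj: "inj_on (cmap d) (cdom d)"
    using M d unfolding locally_definable_space_def by blast
  have "definable_map D (cdim d) (cmap d ` ?I) (cdim c) (cmap c ` ?I) ?g"
    using M c d unfolding locally_definable_space_def by blast
  then have cont: "continuous_map (subtopology (Rn_top (cdim d)) (cmap d ` ?I))
      (subtopology (Rn_top (cdim c)) (cmap c ` ?I)) ?g"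
    unfolding definable_map_def by blast
  have op: "openin (subtopology (Rn_top (cdim d)) (cimg d)) (cmap d ` ?I)"
    using M c d unfolding locally_definable_space_def by blast
  then obtain W where W: "openin (Rn_top (cdim d)) W" "cmap d ` ?I = W \<inter> cimg d"
    unfolding openin_subtopology by blast
  have "continuous_map (subtopology (Rn_top (cdim d)) (cmap d ` ?I)) (Rn_top (cdim c)) ?g"
    using cont by (simp add: continuous_map_in_subtopology)
  then have "openin (subtopology (Rn_top (cdim d)) (cmap d ` ?I))
      {x \<in> topspace (subtopology (Rn_top (cdim d)) (cmap d ` ?I)). ?g x \<in> V}"
    using V openin_continuous_map_preimage by blast
  then obtain T where T: "openin (Rn_top (cdim d)) T"
      "{x \<in> topspace (subtopology (Rn_top (cdim d)) (cmap d ` ?I)). ?g x \<in> V} = T \<inter> cmap d ` ?I"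
    unfolding openin_subtopology by blast
  have sub: "cmap d ` cdom d \<subseteq> Rn (cdim d)"
    using M d \<open>ominimal_expansion D\<close> ominimal_expansion.definable_subset
    unfolding locally_definable_space_def cimg_def by blast
  have "(cmap c -` V \<inter> cdom c) \<inter> cdom d = cmap d -` (T \<inter> W) \<inter> cdom d" (is "?L = ?R")
  proof (intro subset_antisym subsetI)
    fix x assume x: "x \<in> ?L"
    then have "cmap d x \<in> topspace (subtopology (Rn_top (cdim d)) (cmap d ` ?I))"
      using sub by auto
    moreover have "?g (cmap d x) \<in> V" using x inj by simp
    ultimately have "cmap d x \<in> T \<inter> cmap d ` ?I" using T(2) by blast
    then show "x \<in> ?R" using W(2) x by blast
  next
    fix x assume x: "x \<in> ?R"
    then have xI: "cmap d x \<in> cmap d ` ?I" using W(2) by (auto simp: cimg_def)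
    then have "x \<in> cdom c" using x inj by (auto dest: inj_onD)
    have "?g (cmap d x) \<in> V" using xI T(2) x by blast
    then show "x \<in> ?L" using x inj \<open>x \<in> cdom c\<close> by simp
  qed
  then show "openin (pullback_topology (cdom d) (cmap d) (Rn_top (cdim d)))
      (cmap c -` V \<inter> cdom c \<inter> cdom d)"
    unfolding openin_pullback_topology using T(1) W(1) openin_Int by metis
qed

lemma openin_cdom:
  assumes "locally_definable_space D M" "ominimal_expansion D" "c \<in> M"
  shows "openin (ld_top M) (cdom c)"
proof -
  have "cmap c ` cdom c \<subseteq> Rn (cdim c)"
    using assms ominimal_expansion.definable_subset
    unfolding locally_definable_space_def cimg_def by blast
  then have "cmap c -` topspace (Rn_top (cdim c)) \<inter> cdom c = cdom c" by auto
  then show ?thesis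
    using chart_preimage_open[OF assms openin_topspace] by simp
qed

lemma chart_homeomorphic_map:
  assumes "locally_definable_space D M" "ominimal_expansion D" "c \<in> M"
  shows "homeomorphic_map (subtopology (ld_top M) (cdom c))
           (subtopology (Rn_top (cdim c)) (cimg c)) (cmap c)"
proof -
  have inj: "inj_on (cmap c) (cdom c)" and sub: "cimg c \<subseteq> Rn (cdim c)"
    using assms ominimal_expansion.definable_subset
    unfolding locally_definable_space_def by blast+
  have top1: "topspace (subtopology (ld_top M) (cdom c)) = cdom c"
    using openin_cdom[OF assms] openin_subset by fastforce
  have top2: "topspace (subtopology (Rn_top (cdim c)) (cimg c)) = cimg c"
    using sub by auto
  have op: "openin (subtopology (Rn_top (cdim c)) (cimg c)) (cmap c ` U)"
    if U: "openin (subtopology (ld_top M) (cdom c)) U" for U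
  proof -
    obtain T where T: "ld_open M T" "U = T \<inter> cdom c"
      using U unfolding openin_subtopology openin_ld_top by blast
    then obtain V where "openin (Rn_top (cdim c)) V" "U = cmap c -` V \<inter> cdom c"
      using assms(3) unfolding ld_open_def openin_pullback_topology by metis
    moreover from this have "cmap c ` U = V \<inter> cimg c" unfolding cimg_def by blast
    ultimately show ?thesis unfolding openin_subtopology by blast
  qed
  have cont: "openin (subtopology (ld_top M) (cdom c)) {x \<in> cdom c. cmap c x \<in> V}"
    if V: "openin (subtopology (Rn_top (cdim c)) (cimg c)) V" for V
  proof -
    obtain W where W: "openin (Rn_top (cdim c)) W" "V = W \<inter> cimg c"
      using V unfolding openin_subtopology by blast
    have "{x \<in> cdom c. cmap c x \<in> V} = (cmap c -` W \<inter> cdom c) \<inter> cdom c"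
      using W(2) unfolding cimg_def by blast
    then show ?thesis
      using chart_preimage_open[OF assms W(1)] unfolding openin_subtopology by blast
  qed
  show ?thesis
  proof (rule bijective_open_imp_homeomorphic_map)
    show "continuous_map (subtopology (ld_top M) (cdom c))
        (subtopology (Rn_top (cdim c)) (cimg c)) (cmap c)"
      unfolding continuous_map_def top1 top2 using cont by (auto simp: cimg_def)
    show "open_map (subtopology (ld_top M) (cdom c))
        (subtopology (Rn_top (cdim c)) (cimg c)) (cmap c)"
      unfolding open_map_def using op by blast
    show "cmap c ` topspace (subtopology (ld_top M) (cdom c)) =
        topspace (subtopology (Rn_top (cdim c)) (cimg c))"
      unfolding top1 top2 by (simp add: cimg_def)
    show "inj_on (cmap c) (topspace (subtopology (ld_top M) (cdom c)))"
      unfolding top1 by (rule inj)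
  qed
qed


subsection \<open>Serre fibrations\<close>

definition times_I :: "'r::linordered_field list set \<Rightarrow> 'r list set" where
  "times_I X = {x @ [s] |x s. x \<in> X \<and> s \<in> {0..1}}"

definition bounded_Rn :: "nat \<Rightarrow> 'r::linordered_field list set \<Rightarrow> bool" where
  "bounded_Rn m X \<longleftrightarrow> (\<exists>r. \<forall>x\<in>X. \<forall>i<m. \<bar>x ! i\<bar> \<le> r)"

definition serre_fibration ::
  "(nat \<Rightarrow> 'r::real_closed_field list set set) \<Rightarrow> ('e, 'r) chart set \<Rightarrow> ('b, 'r) chart set \<Rightarrow>
    ('e \<Rightarrow> 'b) \<Rightarrow> bool" where
  "serre_fibration D E B p \<longleftrightarrow>
     ld_map D E B p \<and>
     (\<forall>m X f H.
        X \<in> D m \<and> closedin (Rn_top m) X \<and> bounded_Rn m X \<and>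
        ld_map D (def_space m X) E f \<and>
        ld_map D (def_space (Suc m) (times_I X)) B H \<and>
        (\<forall>x\<in>X. H (x @ [0]) = p (f x))
        \<longrightarrow> (\<exists>H'. ld_map D (def_space (Suc m) (times_I X)) E H' \<and>
                 (\<forall>z\<in>times_I X. p (H' z) = H z) \<and>
                 (\<forall>x\<in>X. H' (x @ [0]) = f x)))"


subsection \<open>Homotopy sets and groups\<close>

definition cube :: "nat \<Rightarrow> 'r::linordered_field list set" where
  "cube n = {t \<in> Rn n. \<forall>i<n. 0 \<le> t ! i \<and> t ! i \<le> 1}"

definition cube_boundary :: "nat \<Rightarrow> 'r::linordered_field list set" where
  "cube_boundary n = {t \<in> cube n. \<exists>i<n. t ! i = 0 \<or> t ! i = 1}"

text \<open>The face \<open>I\<^sup>n\<^sup>-\<^sup>1\<close> where the last coordinate vanishes, and \<open>J\<^sup>n\<^sup>-\<^sup>1\<close>; both are meant for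
  \<open>n \<ge> 1\<close>.\<close>

definition cube_face :: "nat \<Rightarrow> 'r::linordered_field list set" where
  "cube_face n = {t \<in> cube n. t ! (n - 1) = 0}"

definition cube_J :: "nat \<Rightarrow> 'r::linordered_field list set" where
  "cube_J n = Rn_top n closure_of (cube_boundary n - cube_face n)"

text \<open>The values of these maps outside the cube are arbitrary; the homotopy relations below identify
  maps that agree on the cube.\<close>

definition rel_maps ::
  "(nat \<Rightarrow> 'r::real_closed_field list set set) \<Rightarrow> nat \<Rightarrow> ('a, 'r) chart set \<Rightarrow> 'a set \<Rightarrow> 'a \<Rightarrow>
    ('r list \<Rightarrow> 'a) set" where
  "rel_maps D n X A x0 =
     {f. ld_map D (def_space n (cube n)) X f \<and> f ` cube_face n \<subseteq> A \<and> f ` cube_J n \<subseteq> {x0}}"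

definition rel_homotopic ::
  "(nat \<Rightarrow> 'r::real_closed_field list set set) \<Rightarrow> nat \<Rightarrow> ('a, 'r) chart set \<Rightarrow> 'a set \<Rightarrow> 'a \<Rightarrow>
    (('r list \<Rightarrow> 'a) \<times> ('r list \<Rightarrow> 'a)) set" where
  "rel_homotopic D n X A x0 =
     {(f, g). f \<in> rel_maps D n X A x0 \<and> g \<in> rel_maps D n X A x0 \<and>
        (\<exists>H. ld_map D (def_space (Suc n) (times_I (cube n))) X H \<and>
             (\<forall>s\<in>{0..1}. (\<lambda>t. H (t @ [s])) \<in> rel_maps D n X A x0) \<and>
             (\<forall>t\<in>cube n. H (t @ [0]) = f t \<and> H (t @ [1]) = g t))}"

definition abs_maps ::
  "(nat \<Rightarrow> 'r::real_closed_field list set set) \<Rightarrow> nat \<Rightarrow> ('a, 'r) chart set \<Rightarrow> 'a \<Rightarrow>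
    ('r list \<Rightarrow> 'a) set" where
  "abs_maps D n X x0 =
     {f. ld_map D (def_space n (cube n)) X f \<and> f ` cube_boundary n \<subseteq> {x0}}"

definition abs_homotopic ::
  "(nat \<Rightarrow> 'r::real_closed_field list set set) \<Rightarrow> nat \<Rightarrow> ('a, 'r) chart set \<Rightarrow> 'a \<Rightarrow>
    (('r list \<Rightarrow> 'a) \<times> ('r list \<Rightarrow> 'a)) set" where
  "abs_homotopic D n X x0 =
     {(f, g). f \<in> abs_maps D n X x0 \<and> g \<in> abs_maps D n X x0 \<and>
        (\<exists>H. ld_map D (def_space (Suc n) (times_I (cube n))) X H \<and>
             (\<forall>t\<in>cube_boundary n. \<forall>s\<in>{0..1}. H (t @ [s]) = f t) \<and>
             (\<forall>t\<in>cube n. H (t @ [0]) = f t \<and> H (t @ [1]) = g t))}"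

text \<open>Juxtaposition along the first coordinate.\<close>

definition juxtapose ::
  "('r::linordered_field list \<Rightarrow> 'a) \<Rightarrow> ('r list \<Rightarrow> 'a) \<Rightarrow> 'r list \<Rightarrow> 'a" where
  "juxtapose f g t =
     (if hd t \<le> 1/2 then f (2 * hd t # tl t) else g ((2 * hd t - 1) # tl t))"

definition class_mult ::
  "(('r::linordered_field list \<Rightarrow> 'a) \<times> ('r list \<Rightarrow> 'a)) set \<Rightarrow>
    ('r list \<Rightarrow> 'a) set \<Rightarrow> ('r list \<Rightarrow> 'a) set \<Rightarrow> ('r list \<Rightarrow> 'a) set" where
  "class_mult r P Q = (\<Union>f\<in>P. \<Union>g\<in>Q. r `` {juxtapose f g})"

text \<open>For \<open>n = 1\<close> only the carrier of \<open>rel_pi\<close>, the relative homotopy set, is meaningful; likewise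
  for \<open>abs_pi\<close> and \<open>n = 0\<close>.\<close>

definition rel_pi ::
  "(nat \<Rightarrow> 'r::real_closed_field list set set) \<Rightarrow> nat \<Rightarrow> ('a, 'r) chart set \<Rightarrow> 'a set \<Rightarrow> 'a \<Rightarrow>
    ('r list \<Rightarrow> 'a) set monoid" where
  "rel_pi D n X A x0 =
     \<lparr>carrier = rel_maps D n X A x0 // rel_homotopic D n X A x0,
      monoid.mult = class_mult (rel_homotopic D n X A x0),
      one = rel_homotopic D n X A x0 `` {\<lambda>_. x0}\<rparr>"

definition abs_pi ::
  "(nat \<Rightarrow> 'r::real_closed_field list set set) \<Rightarrow> nat \<Rightarrow> ('a, 'r) chart set \<Rightarrow> 'a \<Rightarrow>
    ('r list \<Rightarrow> 'a) set monoid" where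
  "abs_pi D n X x0 =
     \<lparr>carrier = abs_maps D n X x0 // abs_homotopic D n X x0,
      monoid.mult = class_mult (abs_homotopic D n X x0),
      one = abs_homotopic D n X x0 `` {\<lambda>_. x0}\<rparr>"

definition induced_map ::
  "(nat \<Rightarrow> 'r::real_closed_field list set set) \<Rightarrow> nat \<Rightarrow> ('b, 'r) chart set \<Rightarrow> 'b \<Rightarrow> ('e \<Rightarrow> 'b) \<Rightarrow>
    ('r list \<Rightarrow> 'e) set \<Rightarrow> ('r list \<Rightarrow> 'b) set" where
  "induced_map D n B b0 p P = (\<Union>f\<in>P. abs_homotopic D n B b0 `` {p \<circ> f})"

text \<open>Fibres of ld-maps are admissible, so the relative homotopy sets of \<open>(E, F, e\<^sub>0)\<close> make sense.\<close>

lemma (in ominimal_expansion) definable_point: "y \<in> Rn n \<Longrightarrow> {y} \<in> D n"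
proof (induction n arbitrary: y)
  case 0
  have "butlast ` {[a]} \<in> D 0" for a
    using definable_projection[of "{[a]}" 0] definable_singleton by simp
  then show ?case using 0 by (simp add: Rn_def)
next
  case (Suc n)
  then obtain a z where y: "y = [a] @ z" "z \<in> Rn n"
    by (cases y) (auto simp: Rn_def)
  have "{u @ v |u v. u \<in> {[a]} \<and> v \<in> {z}} \<in> D (1 + n)"
    by (rule definable_prod[OF definable_singleton Suc.IH[OF y(2)]])
  then show ?case using y by simp
qed

lemma (in ominimal_expansion) definable_take: "A \<in> D (m + n) \<Longrightarrow> take m ` A \<in> D m"
proof (induction n arbitrary: A)
  case 0
  then have "take m ` A = A"
    using definable_subset[OF 0] by (force simp: Rn_def)
  then show ?case using 0 by simp
next
  case (Suc n)
  have "take m ` butlast ` A = take m ` A"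
    unfolding image_image
  proof (rule image_cong[OF refl])
    fix x assume "x \<in> A"
    then have "length x = m + Suc n"
      using definable_subset[OF Suc.prems] by (auto simp: Rn_def)
    then show "take m (butlast x) = take m x"
      by (simp add: butlast_conv_take)
  qed
  moreover have "butlast ` A \<in> D (m + n)"
    using Suc.prems definable_projection by simp
  ultimately show ?case using Suc.IH by metis
qed

lemma (in ominimal_expansion) definable_Int:
  assumes "A \<in> D n" "A' \<in> D n"
  shows "A \<inter> A' \<in> D n"
proof -
  have "A \<inter> A' = Rn n - ((Rn n - A) \<union> (Rn n - A'))"
    using assms definable_subset by blast
  then show ?thesis using assms definable_Un definable_compl by simp
qed

lemma (in ominimal_expansion) admissible_fibre:
  assumes E: "locally_definable_space D E" and B: "locally_definable_space D B"
    and p: "ld_map D E B p" and b0: "b0 \<in> points B"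
  shows "admissible_subspace D E {x \<in> points E. p x = b0}"
  unfolding admissible_subspace_def
proof (intro conjI ballI)
  fix c assume c: "c \<in> E"
  obtain d where d: "d \<in> B" "b0 \<in> cdom d" using b0 unfolding points_def by blast
  have inj: "inj_on (cmap d) (cdom d)" and "cimg d \<in> D (cdim d)" "cimg c \<in> D (cdim c)"
    using E B c d unfolding locally_definable_space_def by blast+
  then have img: "x \<in> cdom c \<Longrightarrow> cmap c x \<in> Rn (cdim c)" "y \<in> cdom d \<Longrightarrow> cmap d y \<in> Rn (cdim d)"
    for x y
    using definable_subset unfolding cimg_def by blast+
  let ?G = "{cmap c x @ cmap d (p x) |x. x \<in> cdom c \<and> p x \<in> cdom d}"
  let ?P = "{u @ v |u v. u \<in> Rn (cdim c) \<and> v \<in> {cmap d b0}}"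
  have "?G \<in> D (cdim c + cdim d)" using p c d unfolding ld_map_def by blast
  moreover have "Rn (cdim c) \<in> D (cdim c)"
    using definable_compl[OF definable_empty] by simp
  then have "?P \<in> D (cdim c + cdim d)"
    using definable_prod definable_point[OF img(2)[OF d(2)]] by blast
  ultimately have "take (cdim c) ` (?G \<inter> ?P) \<in> D (cdim c)"
    using definable_Int definable_take by blast
  moreover have "take (cdim c) ` (?G \<inter> ?P) = cmap c ` ({x \<in> points E. p x = b0} \<inter> cdom c)"
    (is "?L = ?R")
  proof (intro subset_antisym subsetI)
    fix z assume "z \<in> ?L"
    then obtain x u where x: "x \<in> cdom c" "p x \<in> cdom d" "u \<in> Rn (cdim c)"
        "cmap c x @ cmap d (p x) = u @ cmap d b0" "z = take (cdim c) (cmap c x @ cmap d (p x))"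
      by blast
    then have "z = cmap c x" "cmap d (p x) = cmap d b0"
      using img(1)[OF x(1)] by (auto simp: Rn_def)
    moreover from this have "p x = b0" using inj x(2) d(2) by (auto dest: inj_onD)
    ultimately show "z \<in> ?R" using x(1) c unfolding points_def by blast
  next
    fix z assume "z \<in> ?R"
    then obtain x where x: "x \<in> cdom c" "p x = b0" "z = cmap c x" by blast
    then have "cmap c x @ cmap d (p x) \<in> ?G \<inter> ?P" using d(2) img(1)[OF x(1)] by blast
    moreover have "z = take (cdim c) (cmap c x @ cmap d (p x))"
      using x img(1)[OF x(1)] by (simp add: Rn_def)
    ultimately show "z \<in> ?L" by blast
  qed
  ultimately show "cmap c ` ({x \<in> points E. p x = b0} \<inter> cdom c) \<in> D (cdim c)" by simp
qed blast

end

theory Submission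
  imports Defs
begin

text \<open>
  A Serre fibration lifts maps of a cube whose lift is prescribed on a box, that is, on all faces of
  the cube but one.  Instead of straightening the pair (cube, box) by a homeomorphism, use a definable
  deformation \<open>K\<close> of the cube with \<open>K (z, 0)\<close> in the box and \<open>K (z, h z) = z\<close>, where \<open>h\<close> vanishes on
  the box: if \<open>f\<close> is given on the box and \<open>G\<close> on the cube, lift the homotopy \<open>G \<circ> K\<close> starting from
  \<open>f \<circ> K (\<cdot>, 0)\<close> and restrict the lift to the graph of \<open>h\<close>.

  Lifting with the constant \<open>e\<^sub>0\<close> prescribed on \<open>J\<^sup>n\<^sup>-\<^sup>1\<close> gives surjectivity, and lifting homotopies with
  the two ends and \<open>J\<^sup>n\<^sup>-\<^sup>1 \<times> I\<close> prescribed gives injectivity.  So relative homotopy in \<open>E\<close> is exactly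
  the pullback of homotopy in \<open>B\<close>, whence its equivalence and congruence properties.
\<close>

section \<open>Definable sets\<close>

text \<open>A homeomorphism that straightens the box would come with an inverse, and the usual
  radial one involves quotients of coordinates. The deformation \<open>K\<close> itself need not be
  invertible: it is enough that z -> (z, \<open>h z\<close>) is a section of it. Over this section
  the lift of \<open>G \<circ> K\<close> projects to \<open>G\<close>, and on the box, where
  \<open>h\<close> vanishes, the section lies at time 0, where the lift is
  \<open>f (K (z, 0)) = f z\<close>.

  This choice also keeps the analysis elementary. Apart from composition with \<open>p\<close>, new
  maps arise from given ones by reparametrisation, with coordinates formed from constants, sums,
  differences, minima and maxima, and by gluing along finitely many closed definable pieces. Such
  coordinate functions are globally Lipschitz over any ordered field, and their graphs are definable
  by induction. A map into a space with many charts is controlled by its graphs in the charts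
  together with a finite chart cover of its image, so that composition becomes relational
  composition of graphs.\<close>

lemma length_Rn [simp]: "x \<in> Rn n \<longleftrightarrow> length x = n"
  by (simp add: Rn_def)

lemma map_nth_upt: "b \<le> length xs \<Longrightarrow> map ((!) xs) [a..<b] = take (b - a) (drop a xs)"
  by (rule nth_equalityI) auto

lemma list3: "length z = 3 \<longleftrightarrow> (\<exists>a b c. z = [a, b, c])"
  by (auto simp: length_Suc_conv numeral_3_eq_3)

context ominimal_expansion
begin

lemma definable_length: "A \<in> D n \<Longrightarrow> x \<in> A \<Longrightarrow> length x = n"
  using definable_subset by fastforce

lemma definable_Rn: "Rn n \<in> D n"
  using definable_compl[OF definable_empty] by simp

lemma definable_finite_INT:
  "finite I \<Longrightarrow> (\<And>i. i \<in> I \<Longrightarrow> A i \<in> D n) \<Longrightarrow> {x \<in> Rn n. \<forall>i\<in>I. x \<in> A i} \<in> D n"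
proof (induction I rule: finite_induct)
  case empty
  then show ?case using definable_Rn by (simp del: length_Rn)
next
  case (insert i I)
  have "{x \<in> Rn n. \<forall>i\<in>insert i I. x \<in> A i} = A i \<inter> {x \<in> Rn n. \<forall>i\<in>I. x \<in> A i}"
    using insert.prems[of i] definable_subset by blast
  then show ?case using insert definable_Int by simp
qed

lemma definable_finite_UN:
  "finite I \<Longrightarrow> (\<And>i. i \<in> I \<Longrightarrow> A i \<in> D n) \<Longrightarrow> (\<Union>i\<in>I. A i) \<in> D n"
  by (induction I rule: finite_induct) (auto simp: definable_empty definable_Un)

text \<open>Substitution of coordinates, with repetitions and omissions allowed. The closure axioms
  offer products, diagonals and the last projection, so the substituted tuple is adjoined as a block
  \<open>y\<close> in \<open>A\<close>, tied to \<open>x\<close> by diagonals and projected away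
  again.\<close>

lemma definable_reindex:
  assumes A: "A \<in> D m" and len: "length is = m" and sub: "set is \<subseteq> {..<n}"
  shows "{x \<in> Rn n. map ((!) x) is \<in> A} \<in> D n"
proof -
  let ?P = "{x @ y |x y. x \<in> Rn n \<and> y \<in> A}"
  let ?Q = "{z \<in> Rn (n + m). \<forall>i\<in>{..<m}. z \<in> {z \<in> Rn (n + m). z ! (is ! i) = z ! (n + i)}}"
  have "?Q \<in> D (n + m)"
  proof (rule definable_finite_INT)
    fix i assume "i \<in> {..<m}"
    then have "is ! i < n" using len sub nth_mem by fastforce
    then show "{z \<in> Rn (n + m). z ! (is ! i) = z ! (n + i)} \<in> D (n + m)"
      using \<open>i \<in> {..<m}\<close> by (intro definable_diagonal) auto
  qed simp
  then have "take n ` (?P \<inter> ?Q) \<in> D n"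
    using definable_prod[OF definable_Rn A] definable_Int definable_take by blast
  moreover have "take n ` (?P \<inter> ?Q) = {x \<in> Rn n. map ((!) x) is \<in> A}" (is "?L = ?R")
  proof (intro subset_antisym subsetI)
    fix x assume "x \<in> ?L"
    then obtain y where y: "x \<in> Rn n" "y \<in> A" "x @ y \<in> ?Q" by auto
    have ly: "length y = m" using A y(2) definable_length by blast
    have "map ((!) x) is = y"
    proof (rule nth_equalityI)
      fix i assume "i < length (map ((!) x) is)"
      then have i: "i < m" "is ! i < n" using len sub nth_mem by fastforce+
      then have "(x @ y) ! (is ! i) = (x @ y) ! (n + i)" using y(3) by blast
      then show "map ((!) x) is ! i = y ! i"
        using i y(1) len by (auto simp: nth_append)
    qed (simp add: ly len)
    then show "x \<in> ?R" using y by simp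
  next
    fix x assume x: "x \<in> ?R"
    have "x @ map ((!) x) is \<in> ?Q"
      using x len sub nth_mem by (fastforce simp: nth_append)
    then have "x @ map ((!) x) is \<in> ?P \<inter> ?Q" using x by blast
    moreover have "x = take n (x @ map ((!) x) is)" using x by simp
    ultimately show "x \<in> ?L" by blast
  qed
  ultimately show ?thesis by simp
qed

text \<open>Projections remove final coordinates, so the two blocks are exchanged first.\<close>

lemma definable_drop:
  assumes A: "A \<in> D (m + n)"
  shows "drop m ` A \<in> D n"
proof -
  let ?is = "[n..<n + m] @ [0..<n]"
  let ?S = "{z \<in> Rn (n + m). map ((!) z) ?is \<in> A}"
  have "?S \<in> D (n + m)"
    by (intro definable_reindex[OF A]) auto
  then have "take n ` ?S \<in> D n" by (rule definable_take)
  moreover have "take n ` ?S = drop m ` A"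
  proof (intro subset_antisym subsetI)
    fix x assume "x \<in> take n ` ?S"
    then obtain z where z: "length z = n + m" "drop n z @ take n z \<in> A" "x = take n z"
      by (auto simp: map_nth_upt)
    then have "x = drop m (drop n z @ take n z)" by simp
    then show "x \<in> drop m ` A" using z(2) by blast
  next
    fix x assume "x \<in> drop m ` A"
    then obtain y where y: "y \<in> A" "x = drop m y" by blast
    have "length y = m + n" using A y(1) definable_length by blast
    then have "drop m y @ take m y \<in> ?S" "x = take n (drop m y @ take m y)"
      using y by (auto simp: map_nth_upt)
    then show "x \<in> take n ` ?S" by blast
  qed
  ultimately show ?thesis by simp
qed

text \<open>When \<open>A\<close> and \<open>A'\<close> are graphs, this is the graph of the
  composite. The middle block \<open>y\<close> is moved to the end, where the existential quantifier
  over it is a projection.\<close>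

lemma definable_relcomp:
  assumes A: "A \<in> D (m + n)" and A': "A' \<in> D (n + q)"
  shows "{x @ z |x y z. length x = m \<and> length y = n \<and> length z = q \<and> x @ y \<in> A \<and> y @ z \<in> A'}
    \<in> D (m + q)" (is "?R \<in> _")
proof -
  let ?is = "[0..<m] @ [m + q..<m + q + n]" and ?js = "[m + q..<m + q + n] @ [m..<m + q]"
  let ?S = "{w \<in> Rn (m + q + n). map ((!) w) ?is \<in> A} \<inter> {w \<in> Rn (m + q + n). map ((!) w) ?js \<in> A'}"
  have "?S \<in> D (m + q + n)"
    by (intro definable_Int definable_reindex[OF A] definable_reindex[OF A']) auto
  then have "take (m + q) ` ?S \<in> D (m + q)" by (rule definable_take)
  moreover have "take (m + q) ` ?S = ?R"
  proof (intro subset_antisym subsetI)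
    fix w assume "w \<in> take (m + q) ` ?S"
    then obtain v where v: "length v = m + q + n" "take m v @ drop (m + q) v \<in> A"
        "drop (m + q) v @ take q (drop m v) \<in> A'" "w = take (m + q) v"
      by (auto simp: map_nth_upt)
    moreover from this have "w = take m v @ take q (drop m v)" by (simp add: take_add)
    ultimately show "w \<in> ?R"
      by (intro CollectI exI[of _ "take m v"] exI[of _ "drop (m + q) v"]
          exI[of _ "take q (drop m v)"]) simp
  next
    fix w assume "w \<in> ?R"
    then obtain x y z where xyz: "length x = m" "length y = n" "length z = q" "x @ y \<in> A"
        "y @ z \<in> A'" "w = x @ z" by blast
    then have "x @ z @ y \<in> ?S" by (simp add: map_nth_upt)
    moreover have "w = take (m + q) (x @ z @ y)" using xyz by simp
    ultimately show "w \<in> take (m + q) ` ?S" by (rule rev_image_eqI)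
  qed
  ultimately show ?thesis by simp
qed

end


section \<open>Piecewise linear functions\<close>

text \<open>All generators preserve a Lipschitz bound in the sup-norm on the whole of
  \<open>R\<^sup>m\<close>; a product of coordinates has no such bound.\<close>

inductive pl_fun :: "nat \<Rightarrow> ('r::linordered_field list \<Rightarrow> 'r) \<Rightarrow> bool" for m where
  pl_nth: "i < m \<Longrightarrow> pl_fun m (\<lambda>x. x ! i)"
| pl_const: "pl_fun m (\<lambda>x. a)"
| pl_add: "pl_fun m f \<Longrightarrow> pl_fun m g \<Longrightarrow> pl_fun m (\<lambda>x. f x + g x)"
| pl_diff: "pl_fun m f \<Longrightarrow> pl_fun m g \<Longrightarrow> pl_fun m (\<lambda>x. f x - g x)"
| pl_min: "pl_fun m f \<Longrightarrow> pl_fun m g \<Longrightarrow> pl_fun m (\<lambda>x. min (f x) (g x))"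
| pl_max: "pl_fun m f \<Longrightarrow> pl_fun m g \<Longrightarrow> pl_fun m (\<lambda>x. max (f x) (g x))"

lemma lipschitz_ops:
  fixes a :: "'r::linordered_field"
  shows "\<bar>(a + b) - (a' + b')\<bar> \<le> \<bar>a - a'\<bar> + \<bar>b - b'\<bar>"
    and "\<bar>(a - b) - (a' - b')\<bar> \<le> \<bar>a - a'\<bar> + \<bar>b - b'\<bar>"
    and "\<bar>min a b - min a' b'\<bar> \<le> \<bar>a - a'\<bar> + \<bar>b - b'\<bar>"
    and "\<bar>max a b - max a' b'\<bar> \<le> \<bar>a - a'\<bar> + \<bar>b - b'\<bar>"
  by linarith+

text \<open>One induction step for all four binary operations. Here \<open>d\<close> is any bound of
  the coordinate differences rather than their maximum, which covers \<open>m = 0\<close> as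
  well.\<close>

lemma lipschitz_op:
  fixes f g :: "'r::linordered_field list \<Rightarrow> 'r"
  assumes op: "\<And>a b a' b'. \<bar>op a b - op a' b'\<bar> \<le> \<bar>a - a'\<bar> + \<bar>b - b'\<bar>"
    and f: "\<exists>L\<ge>0. \<forall>x y d. (\<forall>i<m. \<bar>y ! i - x ! i\<bar> \<le> d) \<longrightarrow> 0 \<le> d \<longrightarrow> \<bar>f y - f x\<bar> \<le> L * d"
    and g: "\<exists>L\<ge>0. \<forall>x y d. (\<forall>i<m. \<bar>y ! i - x ! i\<bar> \<le> d) \<longrightarrow> 0 \<le> d \<longrightarrow> \<bar>g y - g x\<bar> \<le> L * d"
  shows "\<exists>L\<ge>0. \<forall>x y d. (\<forall>i<m. \<bar>y ! i - x ! i\<bar> \<le> d) \<longrightarrow> 0 \<le> d \<longrightarrow>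
    \<bar>op (f y) (g y) - op (f x) (g x)\<bar> \<le> L * d"
proof -
  obtain K where K: "K \<ge> 0"
      "\<And>x y d. \<forall>i<m. \<bar>y ! i - x ! i\<bar> \<le> d \<Longrightarrow> 0 \<le> d \<Longrightarrow> \<bar>f y - f x\<bar> \<le> K * d"
    using f by blast
  obtain L where L: "L \<ge> 0"
      "\<And>x y d. \<forall>i<m. \<bar>y ! i - x ! i\<bar> \<le> d \<Longrightarrow> 0 \<le> d \<Longrightarrow> \<bar>g y - g x\<bar> \<le> L * d"
    using g by blast
  show ?thesis
  proof (intro exI[of _ "K + L"] conjI allI impI)
    fix x y :: "'r list" and d :: 'r
    assume "\<forall>i<m. \<bar>y ! i - x ! i\<bar> \<le> d" "0 \<le> d"
    then have "\<bar>f y - f x\<bar> \<le> K * d" "\<bar>g y - g x\<bar> \<le> L * d"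
      using K(2) L(2) by blast+
    then show "\<bar>op (f y) (g y) - op (f x) (g x)\<bar> \<le> (K + L) * d"
      using op[of "f y" "g y" "f x" "g x"] by (simp add: distrib_right)
  qed (use K L in simp)
qed

lemma pl_fun_lipschitz:
  assumes "pl_fun m f"
  shows "\<exists>L\<ge>0. \<forall>x y d. (\<forall>i<m. \<bar>y ! i - x ! i\<bar> \<le> d) \<longrightarrow> 0 \<le> d \<longrightarrow> \<bar>f y - f x\<bar> \<le> L * d"
  using assms
proof induction
  case (pl_nth i)
  then show ?case by (intro exI[of _ 1]) auto
next
  case (pl_const a)
  then show ?case by (intro exI[of _ 0]) auto
next
  case (pl_add f g)
  show ?case by (rule lipschitz_op[OF lipschitz_ops(1) pl_add.IH])
next
  case (pl_diff f g)
  show ?case by (rule lipschitz_op[OF lipschitz_ops(2) pl_diff.IH])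
next
  case (pl_min f g)
  show ?case by (rule lipschitz_op[OF lipschitz_ops(3) pl_min.IH])
next
  case (pl_max f g)
  show ?case by (rule lipschitz_op[OF lipschitz_ops(4) pl_max.IH])
qed

lemma openin_pl_less:
  assumes f: "pl_fun m f" and g: "pl_fun m g"
  shows "openin (Rn_top m) {x \<in> Rn m. f x < (g x :: 'r::linordered_field)}"
  unfolding openin_Rn_top Rn_open_def
proof (intro conjI ballI)
  obtain L where L: "L \<ge> 0" "\<And>x y d. \<forall>i<m. \<bar>y ! i - x ! i\<bar> \<le> d \<Longrightarrow> 0 \<le> d \<Longrightarrow>
      \<bar>(g y - f y) - (g x - f x)\<bar> \<le> L * d"
    using pl_fun_lipschitz[OF pl_diff[OF g f]] by blast
  fix x assume x: "x \<in> {x \<in> Rn m. f x < g x}"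
  \<comment> \<open>The difference of \<open>g\<close> and \<open>f\<close> changes by at most
    \<open>L * d\<close>, which has to stay below the gap at \<open>x\<close>. The
    \<open>+ 1\<close> makes this strict and covers \<open>L = 0\<close>.\<close>
  define d where "d = (g x - f x) / (L + 1)"
  have "d > 0" using x L(1) unfolding d_def by auto
  have "L * d < g x - f x" using L(1) x unfolding d_def by (simp add: field_simps)
  show "\<exists>e>0. \<forall>y\<in>Rn m. (\<forall>i<m. \<bar>y ! i - x ! i\<bar> < e) \<longrightarrow> y \<in> {x \<in> Rn m. f x < g x}"
  proof (intro exI[of _ d] conjI ballI impI)
    fix y assume y: "y \<in> Rn m" "\<forall>i<m. \<bar>y ! i - x ! i\<bar> < d"
    then have "\<bar>(g y - f y) - (g x - f x)\<bar> \<le> L * d" using L(2) \<open>d > 0\<close> by (simp add: less_imp_le)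
    then show "y \<in> {x \<in> Rn m. f x < g x}" using y(1) \<open>L * d < g x - f x\<close> by auto
  qed fact
qed auto

text \<open>Coordinates are compared on lists of length \<open>m\<close> only, because
  \<open>butlast\<close> and \<open>tl\<close> are given by coordinate functions only there.\<close>

definition pl_map :: "nat \<Rightarrow> nat \<Rightarrow> ('r::linordered_field list \<Rightarrow> 'r list) \<Rightarrow> bool" where
  "pl_map m n F \<longleftrightarrow> F ` Rn m \<subseteq> Rn n \<and>
     (\<forall>i<n. \<exists>f. pl_fun m f \<and> (\<forall>x\<in>Rn m. F x ! i = f x))"

lemma pl_map_length: "pl_map m n F \<Longrightarrow> length x = m \<Longrightarrow> length (F x) = n"
  by (auto simp: pl_map_def image_subset_iff)

lemma continuous_map_pl:
  fixes F :: "'r::linordered_field list \<Rightarrow> 'r list"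
  assumes F: "pl_map m n F"
  shows "continuous_map (Rn_top m) (Rn_top n) F"
  unfolding continuous_map_def topspace_Rn_top
proof (intro conjI allI impI)
  show "F \<in> Rn m \<rightarrow> Rn n" using F unfolding pl_map_def by blast
  fix V :: "'r list set" assume "openin (Rn_top n) V"
  then have V: "Rn_open n V" by (simp add: openin_Rn_top)
  have "\<forall>i. \<exists>L\<ge>0. i < n \<longrightarrow> (\<forall>x\<in>Rn m. \<forall>y\<in>Rn m. \<forall>d. (\<forall>j<m. \<bar>y ! j - x ! j\<bar> \<le> d) \<longrightarrow> 0 \<le> d \<longrightarrow>
      \<bar>F y ! i - F x ! i\<bar> \<le> L * d)"
  proof
    fix i
    show "\<exists>L\<ge>0. i < n \<longrightarrow> (\<forall>x\<in>Rn m. \<forall>y\<in>Rn m. \<forall>d. (\<forall>j<m. \<bar>y ! j - x ! j\<bar> \<le> d) \<longrightarrow> 0 \<le> d \<longrightarrow>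
      \<bar>F y ! i - F x ! i\<bar> \<le> L * d)"
    proof (cases "i < n")
      case True
      then obtain f where f: "pl_fun m f" "\<forall>x\<in>Rn m. F x ! i = f x"
        using F unfolding pl_map_def by blast
      obtain L where "L \<ge> 0" "\<And>x y d. \<forall>j<m. \<bar>y ! j - x ! j\<bar> \<le> d \<Longrightarrow> 0 \<le> d \<Longrightarrow>
          \<bar>f y - f x\<bar> \<le> L * d"
        using pl_fun_lipschitz[OF f(1)] by blast
      then show ?thesis using f(2) by (intro exI[of _ L]) (simp del: length_Rn)
    qed auto
  qed
  then obtain L where L: "\<And>i. L i \<ge> 0" "\<And>i x y d. i < n \<Longrightarrow> x \<in> Rn m \<Longrightarrow> y \<in> Rn m \<Longrightarrow>
      \<forall>j<m. \<bar>y ! j - x ! j\<bar> \<le> d \<Longrightarrow> 0 \<le> d \<Longrightarrow> \<bar>F y ! i - F x ! i\<bar> \<le> L i * d"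
    by metis
  \<comment> \<open>A single constant strictly above every \<open>L i\<close>; the summand 1 also
    keeps it positive when \<open>n = 0\<close>.\<close>
  define S where "S = 1 + (\<Sum>i<n. L i)"
  have S: "S > 0" "\<And>i. i < n \<Longrightarrow> L i < S"
  proof -
    show "S > 0" unfolding S_def using L(1) by (simp add: add_pos_nonneg sum_nonneg)
    fix i assume "i < n"
    then have "L i \<le> (\<Sum>i<n. L i)" using L(1) by (intro member_le_sum) auto
    then show "L i < S" unfolding S_def by simp
  qed
  show "openin (Rn_top m) {x \<in> Rn m. F x \<in> V}"
    unfolding openin_Rn_top Rn_open_def
  proof (intro conjI ballI)
    fix x assume x: "x \<in> {x \<in> Rn m. F x \<in> V}"
    then obtain e where e: "e > 0" "\<And>y. y \<in> Rn n \<Longrightarrow> \<forall>i<n. \<bar>y ! i - F x ! i\<bar> < e \<Longrightarrow> y \<in> V"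
      using V unfolding Rn_open_def by blast
    show "\<exists>e>0. \<forall>y\<in>Rn m. (\<forall>i<m. \<bar>y ! i - x ! i\<bar> < e) \<longrightarrow> y \<in> {x \<in> Rn m. F x \<in> V}"
    proof (intro exI[of _ "e / S"] conjI ballI impI)
      show "e / S > 0" using e S by simp
      fix y assume y: "y \<in> Rn m" "\<forall>i<m. \<bar>y ! i - x ! i\<bar> < e / S"
      have "\<bar>F y ! i - F x ! i\<bar> < e" if "i < n" for i
      proof -
        have "\<bar>F y ! i - F x ! i\<bar> \<le> L i * (e / S)"
          using x y \<open>e / S > 0\<close> that by (intro L(2)) (auto simp: less_imp_le)
        also have "\<dots> < S * (e / S)"
          using S(2)[OF that] \<open>e / S > 0\<close> by (rule mult_strict_right_mono)
        finally show ?thesis using S by simp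
      qed
      moreover have "F y \<in> Rn n" using F y(1) unfolding pl_map_def by blast
      ultimately show "y \<in> {x \<in> Rn m. F x \<in> V}" using e(2) y(1) by blast
    qed
  qed auto
qed

section \<open>Definability of piecewise linear graphs and inequalities\<close>

context ominimal_expansion
begin

lemma definable_op_graph:
  assumes op: "{[a, b, op a b] |a b. True} \<in> D 3"
    and f: "{z \<in> Rn (Suc m). z ! m = f (take m z)} \<in> D (Suc m)"
    and g: "{z \<in> Rn (Suc m). z ! m = g (take m z)} \<in> D (Suc m)"
  shows "{z \<in> Rn (Suc m). z ! m = op (f (take m z)) (g (take m z))} \<in> D (Suc m)"
proof -
  \<comment> \<open>Coordinates below \<open>m\<close> carry the argument, \<open>m\<close> the
    result, \<open>m + 1\<close> and \<open>m + 2\<close> the values of \<open>f\<close> and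
    \<open>g\<close>; these last two are projected away.\<close>
  let ?n = "Suc m + 2"
  let ?S = "{w \<in> Rn ?n. map ((!) w) ([0..<m] @ [m + 1]) \<in> {z \<in> Rn (Suc m). z ! m = f (take m z)}} \<inter>
    ({w \<in> Rn ?n. map ((!) w) ([0..<m] @ [m + 2]) \<in> {z \<in> Rn (Suc m). z ! m = g (take m z)}} \<inter>
    {w \<in> Rn ?n. map ((!) w) [m + 1, m + 2, m] \<in> {[a, b, op a b] |a b. True}})"
  have "?S \<in> D ?n"
    by (intro definable_Int definable_reindex[OF f] definable_reindex[OF g]
        definable_reindex[OF op]) auto
  then have "take (Suc m) ` ?S \<in> D (Suc m)" by (rule definable_take)
  moreover have "take (Suc m) ` ?S = {z \<in> Rn (Suc m). z ! m = op (f (take m z)) (g (take m z))}"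
    (is "_ = ?R")
  proof (intro subset_antisym subsetI)
    fix z assume "z \<in> take (Suc m) ` ?S"
    then obtain w where w: "w \<in> ?S" "z = take (Suc m) w" by (rule imageE)
    then show "z \<in> ?R" by (auto simp: map_nth_upt nth_append min_def)
  next
    fix z assume z: "z \<in> ?R"
    have "z @ [f (take m z), g (take m z)] \<in> ?S"
      using z by (auto simp: map_nth_upt nth_append)
    moreover have "z = take (Suc m) (z @ [f (take m z), g (take m z)])" using z by simp
    ultimately show "z \<in> take (Suc m) ` ?S" by (rule rev_image_eqI)
  qed
  ultimately show ?thesis by simp
qed

lemma definable_nth_le:
  assumes "i < n" "j < n"
  shows "{z \<in> Rn n. z ! i \<le> z ! j} \<in> D n"
proof -
  have "{z \<in> Rn n. map ((!) z) [j, i] \<in> {[x, y] |x y. x < y}} \<in> D n"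
    using assms by (intro definable_reindex[OF definable_less]) auto
  from definable_compl[OF this] show ?thesis
    by (rule back_subst[of "\<lambda>S. S \<in> D n"]) auto
qed

lemma definable_pl_graph:
  assumes "pl_fun m f"
  shows "{z \<in> Rn (Suc m). z ! m = f (take m z)} \<in> D (Suc m)"
  using assms
proof induction
  case (pl_nth i)
  have "{z \<in> Rn (Suc m). z ! m = take m z ! i} = {z \<in> Rn (Suc m). z ! m = z ! i}"
    using pl_nth by auto
  then show ?case using definable_diagonal[of m "Suc m" i] pl_nth by simp
next
  case (pl_const a)
  have "{z \<in> Rn (Suc m). map ((!) z) [m] \<in> {[a]}} \<in> D (Suc m)"
    by (intro definable_reindex[OF definable_singleton]) auto
  then show ?case by simp
next
  case (pl_add f g)
  show ?case by (rule definable_op_graph[OF definable_add pl_add.IH])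
next
  case (pl_diff f g)
  \<comment> \<open>The relation \<open>c = a - b\<close> is read as \<open>a = b + c\<close>, the
    graph of addition with permuted coordinates.\<close>
  have "{z \<in> Rn 3. map ((!) z) [1, 2, 0] \<in> {[x, y, x + y] |x y. True}} \<in> D 3"
    by (intro definable_reindex[OF definable_add]) auto
  also have "{z \<in> Rn 3. map ((!) z) [1, 2, 0] \<in> {[x, y, x + y] |x y. True}} =
      {[a, b, a - b] |a b :: 'r. True}"
    by (auto simp: list3)
  finally show ?case using pl_diff.IH by (rule definable_op_graph)
next
  case (pl_min f g)
  have "{z \<in> Rn 3. z ! 0 \<le> z ! 1} \<inter> {z \<in> Rn 3. z ! 2 = z ! 0} \<union>
      {z \<in> Rn 3. z ! 1 \<le> z ! 0} \<inter> {z \<in> Rn 3. z ! 2 = z ! 1} \<in> D 3"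
    by (intro definable_Un definable_Int definable_nth_le definable_diagonal) auto
  also have "{z \<in> Rn 3. z ! 0 \<le> z ! 1} \<inter> {z \<in> Rn 3. z ! 2 = z ! 0} \<union>
      {z \<in> Rn 3. z ! 1 \<le> z ! 0} \<inter> {z \<in> Rn 3. z ! 2 = z ! 1} = {[a, b, min a b] |a b :: 'r. True}"
    by (auto simp: list3 min.absorb1 min.absorb2)
  finally show ?case using pl_min.IH by (rule definable_op_graph)
next
  case (pl_max f g)
  have "{z \<in> Rn 3. z ! 0 \<le> z ! 1} \<inter> {z \<in> Rn 3. z ! 2 = z ! 1} \<union>
      {z \<in> Rn 3. z ! 1 \<le> z ! 0} \<inter> {z \<in> Rn 3. z ! 2 = z ! 0} \<in> D 3"
    by (intro definable_Un definable_Int definable_nth_le definable_diagonal) auto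
  also have "{z \<in> Rn 3. z ! 0 \<le> z ! 1} \<inter> {z \<in> Rn 3. z ! 2 = z ! 1} \<union>
      {z \<in> Rn 3. z ! 1 \<le> z ! 0} \<inter> {z \<in> Rn 3. z ! 2 = z ! 0} = {[a, b, max a b] |a b :: 'r. True}"
    by (auto simp: list3 max.absorb1 max.absorb2)
  finally show ?case using pl_max.IH by (rule definable_op_graph)
qed

lemma definable_pl_le:
  assumes f: "pl_fun m f" and g: "pl_fun m g"
  shows "{x \<in> Rn m. f x \<le> g x} \<in> D m"
proof -
  let ?f = "{z \<in> Rn (Suc m). z ! m = f (take m z)}" and ?g = "{z \<in> Rn (Suc m). z ! m = g (take m z)}"
  let ?S = "{w \<in> Rn (m + 2). map ((!) w) ([0..<m] @ [m]) \<in> ?f} \<inter>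
    ({w \<in> Rn (m + 2). map ((!) w) ([0..<m] @ [m + 1]) \<in> ?g} \<inter> {w \<in> Rn (m + 2). w ! m \<le> w ! (m + 1)})"
  have "?S \<in> D (m + 2)"
    by (intro definable_Int definable_reindex[OF definable_pl_graph[OF f]]
        definable_reindex[OF definable_pl_graph[OF g]] definable_nth_le) auto
  then have "take m ` ?S \<in> D m" by (rule definable_take)
  moreover have "take m ` ?S = {x \<in> Rn m. f x \<le> g x}"
  proof (intro subset_antisym subsetI)
    fix x assume "x \<in> take m ` ?S"
    then show "x \<in> {x \<in> Rn m. f x \<le> g x}" by (auto simp: map_nth_upt nth_append)
  next
    fix x assume x: "x \<in> {x \<in> Rn m. f x \<le> g x}"
    then have "x @ [f x, g x] \<in> ?S" by (auto simp: map_nth_upt nth_append)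
    moreover have "x = take m (x @ [f x, g x])" using x by simp
    ultimately show "x \<in> take m ` ?S" by (rule rev_image_eqI)
  qed
  ultimately show ?thesis by simp
qed

lemma definable_pl_map_graph:
  assumes F: "pl_map m n F" and Y: "Y \<in> D m"
  shows "{x @ F x |x. x \<in> Y} \<in> D (m + n)"
proof -
  have "\<forall>i. \<exists>f. i < n \<longrightarrow> pl_fun m f \<and> (\<forall>x\<in>Rn m. F x ! i = f x)"
    using F unfolding pl_map_def by blast
  then obtain f where f: "\<And>i. i < n \<Longrightarrow> pl_fun m (f i)"
      "\<And>i x. i < n \<Longrightarrow> x \<in> Rn m \<Longrightarrow> F x ! i = f i x"
    by metis
  let ?G = "\<lambda>i. {z \<in> Rn (Suc m). z ! m = f i (take m z)}"
  let ?S = "{z \<in> Rn (m + n). map ((!) z) [0..<m] \<in> Y} \<inter>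
    {z \<in> Rn (m + n). \<forall>i\<in>{..<n}. z \<in> {z \<in> Rn (m + n). map ((!) z) ([0..<m] @ [m + i]) \<in> ?G i}}"
  have "?S \<in> D (m + n)"
    by (intro definable_Int definable_finite_INT definable_reindex[OF Y]
        definable_reindex[OF definable_pl_graph[OF f(1)]]) auto
  moreover have "?S = {x @ F x |x. x \<in> Y}"
  proof (intro subset_antisym subsetI)
    fix z assume z: "z \<in> ?S"
    then have Yz: "take m z \<in> Y" and lz: "length z = m + n" by (auto simp: map_nth_upt)
    have lF: "length (F (take m z)) = n" using pl_map_length[OF F] lz by simp
    have "drop m z = F (take m z)"
    proof (rule nth_equalityI)
      fix i assume "i < length (drop m z)"
      then have i: "i < n" using lz by simp
      then have "z ! (m + i) = f i (take m z)"
        using z by (auto simp: map_nth_upt nth_append)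
      then show "drop m z ! i = F (take m z) ! i" using f(2)[OF i] lz by simp
    qed (simp add: lz lF)
    then have "z = take m z @ F (take m z)" by (metis append_take_drop_id)
    then show "z \<in> {x @ F x |x. x \<in> Y}" using Yz by blast
  next
    fix z assume "z \<in> {x @ F x |x. x \<in> Y}"
    then obtain x where x: "x \<in> Y" "z = x @ F x" by blast
    have lx: "length x = m" using definable_length Y x(1) by blast
    then have lF: "length (F x) = n" by (rule pl_map_length[OF F])
    show "z \<in> ?S" using x lx lF f(2) by (auto simp: map_nth_upt nth_append)
  qed
  ultimately show ?thesis by simp
qed

text \<open>The pieces along which maps are glued: closedness serves continuity, definability serves
  the graphs.\<close>

definition closed_definable :: "nat \<Rightarrow> 'r list set \<Rightarrow> bool" where
  "closed_definable m X \<longleftrightarrow> X \<in> D m \<and> closedin (Rn_top m) X"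

lemma closed_definable_le:
  assumes "pl_fun m f" "pl_fun m g"
  shows "closed_definable m {x \<in> Rn m. f x \<le> g x}"
proof -
  have "Rn m - {x \<in> Rn m. f x \<le> g x} = {x \<in> Rn m. g x < f x}" by auto
  then show ?thesis
    using definable_pl_le[OF assms] openin_pl_less[OF assms(2,1)]
    by (auto simp: closed_definable_def closedin_def simp del: length_Rn)
qed

lemma closed_definable_Int:
  "closed_definable m X \<Longrightarrow> closed_definable m Y \<Longrightarrow> closed_definable m (X \<inter> Y)"
  by (simp add: closed_definable_def definable_Int closedin_Int)

lemma closed_definable_Un:
  "closed_definable m X \<Longrightarrow> closed_definable m Y \<Longrightarrow> closed_definable m (X \<union> Y)"
  by (simp add: closed_definable_def definable_Un closedin_Un)

lemma closed_definable_eq: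
  assumes "pl_fun m f" "pl_fun m g"
  shows "closed_definable m {x \<in> Rn m. f x = g x}"
  using closed_definable_Int[OF closed_definable_le[OF assms] closed_definable_le[OF assms(2,1)]]
  by (rule back_subst[of "closed_definable m"]) auto

lemma closed_definable_UN:
  "finite I \<Longrightarrow> (\<And>i. i \<in> I \<Longrightarrow> closed_definable m (X i)) \<Longrightarrow> closed_definable m (\<Union>i\<in>I. X i)"
  by (auto simp: closed_definable_def intro!: definable_finite_UN closedin_Union)

lemma closed_definable_Rn: "closed_definable m (Rn m)"
  using definable_Rn closedin_topspace[of "Rn_top m"] by (simp add: closed_definable_def)

lemma closed_definable_INT:
  "finite I \<Longrightarrow> (\<And>i. i \<in> I \<Longrightarrow> closed_definable m (X i)) \<Longrightarrow>
    closed_definable m {x \<in> Rn m. \<forall>i\<in>I. x \<in> X i}"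
proof (induction I rule: finite_induct)
  case empty
  then show ?case using closed_definable_Rn by (simp del: length_Rn)
next
  case (insert i I)
  have "{x \<in> Rn m. \<forall>i\<in>insert i I. x \<in> X i} = X i \<inter> {x \<in> Rn m. \<forall>i\<in>I. x \<in> X i}"
    using insert.prems[of i] definable_subset unfolding closed_definable_def by blast
  then show ?case using insert closed_definable_Int by simp
qed

end


section \<open>Maps from definable sets to locally definable spaces\<close>

lemma ld_top_def_space: "ld_top (def_space m X) = subtopology (Rn_top m) X"
  unfolding topology_eq openin_ld_top
  by (auto simp: ld_open_def def_space_def points_def openin_pullback_topology openin_subtopology)

context ominimal_expansion
begin

lemma length_cmap:
  assumes "locally_definable_space D N" "d \<in> N" "x \<in> cdom d"
  shows "length (cmap d x) = cdim d"
  using assms definable_length unfolding locally_definable_space_def cimg_def by blast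

text \<open>The image of \<open>f\<close> in a chart is a projection of the graph there, which
  reduces \<open>definable_subspace\<close> for the image to a finite cover by charts.\<close>

lemma ld_map_def_space:
  assumes N: "locally_definable_space D N"
  shows "ld_map D (def_space m X) N f \<longleftrightarrow>
    (\<exists>C. finite C \<and> C \<subseteq> N \<and> f ` X \<subseteq> points C) \<and>
    continuous_map (subtopology (Rn_top m) X) (ld_top N) f \<and>
    (\<forall>d\<in>N. {x @ cmap d (f x) |x. x \<in> X \<and> f x \<in> cdom d} \<in> D (m + cdim d))"
    (is "?L \<longleftrightarrow> ?fin \<and> ?cont \<and> ?graph")
proof -
  have L: "?L \<longleftrightarrow> definable_subspace D N (f ` X) \<and> ?cont \<and> ?graph"
    by (simp add: ld_map_def ld_top_def_space subtopology_subtopology) (simp add: def_space_def)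
  have "cmap d ` (f ` X \<inter> cdom d) \<in> D (cdim d)" if ?graph ?cont "d \<in> N" for d
  proof -
    let ?G = "{x @ cmap d (f x) |x. x \<in> X \<and> f x \<in> cdom d}"
    have G: "?G \<in> D (m + cdim d)" using that by blast
    \<comment> \<open>Nothing is known about \<open>X\<close> itself here; the length of
      \<open>x\<close> is read off the definable graph.\<close>
    have len: "length x = m" if "x \<in> X" "f x \<in> cdom d" for x
    proof -
      have "length (x @ cmap d (f x)) = m + cdim d" using definable_length[OF G] that by blast
      then show ?thesis using length_cmap[OF N \<open>d \<in> N\<close> that(2)] by simp
    qed
    have "cmap d ` (f ` X \<inter> cdom d) = drop m ` ?G"
    proof (intro subset_antisym subsetI)
      fix y assume "y \<in> cmap d ` (f ` X \<inter> cdom d)"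
      then obtain x where x: "x \<in> X" "f x \<in> cdom d" "y = cmap d (f x)" by blast
      then have "y = drop m (x @ cmap d (f x))" using len by simp
      then show "y \<in> drop m ` ?G" using x by blast
    next
      fix y assume "y \<in> drop m ` ?G"
      then show "y \<in> cmap d ` (f ` X \<inter> cdom d)" using len by auto
    qed
    then show ?thesis using definable_drop[OF G] by simp
  qed
  then have "definable_subspace D N (f ` X) \<longleftrightarrow> ?fin" if ?graph ?cont
    using that unfolding definable_subspace_def by blast
  then show ?thesis unfolding L by blast
qed

lemma
  assumes N: "locally_definable_space D N" and f: "ld_map D (def_space m X) N f"
  shows ld_map_finite_charts: "\<exists>C. finite C \<and> C \<subseteq> N \<and> f ` X \<subseteq> points C"
    and ld_map_continuous: "continuous_map (subtopology (Rn_top m) X) (ld_top N) f"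
    and ld_map_graph: "d \<in> N \<Longrightarrow> {x @ cmap d (f x) |x. x \<in> X \<and> f x \<in> cdom d} \<in> D (m + cdim d)"
  using f unfolding ld_map_def_space[OF N] by simp_all

lemma ld_map_cong:
  assumes "\<And>x. x \<in> X \<Longrightarrow> f x = g x"
  shows "ld_map D (def_space m X) N f \<longleftrightarrow> ld_map D (def_space m X) N g"
proof -
  have "continuous_map (subtopology (Rn_top m) X) (ld_top N) f \<longleftrightarrow>
      continuous_map (subtopology (Rn_top m) X) (ld_top N) g"
    using assms by (auto intro: continuous_map_eq)
  moreover have "{x @ cmap d (f x) |x. x \<in> X \<and> f x \<in> cdom d} =
      {x @ cmap d (g x) |x. x \<in> X \<and> g x \<in> cdom d}" for d :: "('a, 'r) chart"
    using assms by (intro Collect_cong) metis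
  moreover have "f ` X = g ` X" using assms by simp
  ultimately show ?thesis
    by (simp add: ld_map_def ld_top_def_space subtopology_subtopology) (simp add: def_space_def)
qed

lemma ld_map_const:
  assumes N: "locally_definable_space D N" and X: "X \<in> D m" and a: "a \<in> points N"
  shows "ld_map D (def_space m X) N (\<lambda>_. a)"
  unfolding ld_map_def_space[OF N]
proof (intro conjI ballI)
  obtain c where "c \<in> N" "a \<in> cdom c" using a unfolding points_def by blast
  then show "\<exists>C. finite C \<and> C \<subseteq> N \<and> (\<lambda>_. a) ` X \<subseteq> points C"
    by (intro exI[of _ "{c}"]) (auto simp: points_def)
  show "continuous_map (subtopology (Rn_top m) X) (ld_top N) (\<lambda>_. a)"
    using a topspace_ld_top[OF N ominimal_expansion_axioms] by simp
  fix d assume d: "d \<in> N"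
  show "{x @ cmap d a |x. x \<in> X \<and> a \<in> cdom d} \<in> D (m + cdim d)"
  proof (cases "a \<in> cdom d")
    case True
    have "{cmap d a} \<in> D (cdim d)"
      using length_cmap[OF N d True] by (intro definable_point) simp
    from definable_prod[OF X this] show ?thesis using True by simp
  qed (simp add: definable_empty)
qed

text \<open>All reparametrisations of cubes below go through this lemma. In each chart the graph of
  the composite is the relational composition of the graph of \<open>F\<close> with that of
  \<open>f\<close>.\<close>

lemma ld_map_pl_comp:
  assumes N: "locally_definable_space D N" and f: "ld_map D (def_space n X) N f"
    and F: "pl_map m n F" and Y: "Y \<in> D m" and sub: "F ` Y \<subseteq> X"
  shows "ld_map D (def_space m Y) N (\<lambda>y. f (F y))"
proof -
  have lY: "length y = m" if "y \<in> Y" for y using Y that definable_length by blast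
  have lF: "length (F y) = n" if "y \<in> Y" for y using pl_map_length[OF F lY[OF that]] .
  have "continuous_map (subtopology (Rn_top m) Y) (subtopology (Rn_top n) X) F"
    using continuous_map_from_subtopology[OF continuous_map_pl[OF F]] sub
    by (auto simp: continuous_map_in_subtopology)
  moreover have "continuous_map (subtopology (Rn_top n) X) (ld_top N) f"
    by (rule ld_map_continuous[OF N f])
  ultimately have "continuous_map (subtopology (Rn_top m) Y) (ld_top N) (\<lambda>y. f (F y))"
    unfolding comp_def[of f F, symmetric] by (rule continuous_map_compose)
  moreover have "\<exists>C. finite C \<and> C \<subseteq> N \<and> (\<lambda>y. f (F y)) ` Y \<subseteq> points C"
  proof -
    obtain C where "finite C" "C \<subseteq> N" "f ` X \<subseteq> points C"
      using ld_map_finite_charts[OF N f] by blast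
    then show ?thesis using sub by (intro exI[of _ C]) (simp add: image_subset_iff)
  qed
  moreover have "{y @ cmap d (f (F y)) |y. y \<in> Y \<and> f (F y) \<in> cdom d} \<in> D (m + cdim d)"
    if d: "d \<in> N" for d
  proof -
    let ?F = "{y @ F y |y. y \<in> Y}" and ?G = "{x @ cmap d (f x) |x. x \<in> X \<and> f x \<in> cdom d}"
    have G: "?G \<in> D (n + cdim d)" by (rule ld_map_graph[OF N f d])
    have "{x @ z |x y z. length x = m \<and> length y = n \<and> length z = cdim d \<and> x @ y \<in> ?F \<and> y @ z \<in> ?G}
      = {y @ cmap d (f (F y)) |y. y \<in> Y \<and> f (F y) \<in> cdom d}" (is "?L = ?R")
    proof (intro subset_antisym subsetI)
      fix w assume "w \<in> ?L"
      then obtain x y z where w: "w = x @ z" "length x = m" "length y = n" "length z = cdim d"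
          "x @ y \<in> ?F" "y @ z \<in> ?G" by blast
      obtain x' where x': "x' \<in> Y" "x @ y = x' @ F x'" using w(5) by blast
      obtain y' where y': "f y' \<in> cdom d" "y @ z = y' @ cmap d (f y')" using w(6) by blast
      have "x = x'" "y = F x'" using x' w lY by auto
      moreover have "y = y'" "z = cmap d (f y')"
        using y' w(4) length_cmap[OF N d y'(1)] by auto
      ultimately show "w \<in> ?R" using w(1) x'(1) y'(1) by blast
    next
      fix w assume "w \<in> ?R"
      then obtain y where y: "y \<in> Y" "f (F y) \<in> cdom d" "w = y @ cmap d (f (F y))" by blast
      moreover have "F y @ cmap d (f (F y)) \<in> ?G" using y sub by blast
      ultimately show "w \<in> ?L"
        using lY lF length_cmap[OF N d y(2)] by blast
    qed
    then show ?thesis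
      using definable_relcomp[OF definable_pl_map_graph[OF F Y] G] by simp
  qed
  ultimately show ?thesis unfolding ld_map_def_space[OF N] by blast
qed

text \<open>By definition an ld-map is continuous on each chart domain; these are open and cover the
  space, so the local statements paste.\<close>

lemma continuous_map_ld_map:
  assumes E: "locally_definable_space D E" and p: "ld_map D E B p"
  shows "continuous_map (ld_top E) (ld_top B) p"
proof (rule pasting_lemma[of E "ld_top E" cdom _ "\<lambda>_. p"])
  show "openin (ld_top E) (cdom c)" if "c \<in> E" for c
    using openin_cdom[OF E ominimal_expansion_axioms that] .
  show "continuous_map (subtopology (ld_top E) (cdom c)) (ld_top B) p" if "c \<in> E" for c
    using p that unfolding ld_map_def by blast
  show "\<exists>c. c \<in> E \<and> x \<in> cdom c \<and> p x = p x" if "x \<in> topspace (ld_top E)" for x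
    using that topspace_ld_top[OF E ominimal_expansion_axioms] by (auto simp: points_def)
qed (rule refl)

text \<open>The intermediate point \<open>f x\<close> has to be read in some chart of
  \<open>E\<close>. Finitely many charts cover the image of \<open>f\<close>, so the graph of the
  composite is a finite union of relational compositions, one for each of these charts.\<close>

lemma ld_map_post_comp:
  assumes E: "locally_definable_space D E" and B: "locally_definable_space D B"
    and p: "ld_map D E B p" and f: "ld_map D (def_space m X) E f" and X: "X \<in> D m"
  shows "ld_map D (def_space m X) B (\<lambda>x. p (f x))"
proof -
  obtain C where C: "finite C" "C \<subseteq> E" "f ` X \<subseteq> points C"
    using ld_map_finite_charts[OF E f] by blast
  have "\<exists>C'. finite C' \<and> C' \<subseteq> B \<and> p ` cdom c \<subseteq> points C'" if "c \<in> C" for c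
  proof -
    have "definable_subspace D B (p ` cdom c)" using p that C(2) unfolding ld_map_def by auto
    then show ?thesis unfolding definable_subspace_def by auto
  qed
  then obtain K where K: "\<And>c. c \<in> C \<Longrightarrow> finite (K c) \<and> K c \<subseteq> B \<and> p ` cdom c \<subseteq> points (K c)"
    by metis
  have "(\<lambda>x. p (f x)) ` X \<subseteq> points (\<Union>c\<in>C. K c)"
  proof (intro subsetI, elim imageE)
    fix y x assume x: "x \<in> X" "y = p (f x)"
    then obtain c where "c \<in> C" "f x \<in> cdom c" using C(3) unfolding points_def by blast
    then show "y \<in> points (\<Union>c\<in>C. K c)" using K x(2) unfolding points_def by blast
  qed
  then have "\<exists>C. finite C \<and> C \<subseteq> B \<and> (\<lambda>x. p (f x)) ` X \<subseteq> points C"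
    using K C(1) by (intro exI[of _ "\<Union>c\<in>C. K c"]) auto
  moreover have "continuous_map (subtopology (Rn_top m) X) (ld_top B) (\<lambda>x. p (f x))"
    using continuous_map_compose[OF ld_map_continuous[OF E f] continuous_map_ld_map[OF E p]]
    by (simp add: comp_def)
  moreover have "{x @ cmap d (p (f x)) |x. x \<in> X \<and> p (f x) \<in> cdom d} \<in> D (m + cdim d)"
    if d: "d \<in> B" for d
  proof -
    let ?f = "\<lambda>c. {x @ cmap c (f x) |x. x \<in> X \<and> f x \<in> cdom c}"
    let ?p = "\<lambda>c. {cmap c x @ cmap d (p x) |x. x \<in> cdom c \<and> p x \<in> cdom d}"
    let ?S = "\<lambda>c. {x @ z |x y z. length x = m \<and> length y = cdim c \<and> length z = cdim d \<and>
      x @ y \<in> ?f c \<and> y @ z \<in> ?p c}"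
    have "(\<Union>c\<in>C. ?S c) \<in> D (m + cdim d)"
    proof (intro definable_finite_UN C(1) definable_relcomp)
      fix c assume c: "c \<in> C"
      show "?f c \<in> D (m + cdim c)" using ld_map_graph[OF E f] c C(2) by blast
      show "?p c \<in> D (cdim c + cdim d)" using p d c C(2) unfolding ld_map_def by blast
    qed
    moreover have "(\<Union>c\<in>C. ?S c) = {x @ cmap d (p (f x)) |x. x \<in> X \<and> p (f x) \<in> cdom d}"
      (is "?L = ?R")
    proof (intro subset_antisym subsetI)
      fix w assume "w \<in> ?L"
      then obtain c x y z where w: "c \<in> C" "w = x @ z" "length x = m" "length y = cdim c"
          "length z = cdim d" "x @ y \<in> ?f c" "y @ z \<in> ?p c" by blast
      have cE: "c \<in> E" using w(1) C(2) by blast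
      obtain x' where x': "x' \<in> X" "f x' \<in> cdom c" "x @ y = x' @ cmap c (f x')" using w(6) by blast
      obtain y' where y': "y' \<in> cdom c" "p y' \<in> cdom d" "y @ z = cmap c y' @ cmap d (p y')"
        using w(7) by blast
      have "x = x'" "y = cmap c (f x')" using x' w(4) length_cmap[OF E cE x'(2)] by auto
      moreover have "y = cmap c y'" "z = cmap d (p y')"
        using y' w(4) length_cmap[OF E cE y'(1)] by auto
      \<comment> \<open>The two graphs share only the coordinate vector \<open>y\<close>;
        injectivity of the chart turns this into equality of points of \<open>E\<close>.\<close>
      moreover have "inj_on (cmap c) (cdom c)"
        using E cE unfolding locally_definable_space_def by blast
      ultimately have "y' = f x'" using x'(2) y'(1) by (metis inj_onD)
      then show "w \<in> ?R" using w(2) x'(1) y'(2) \<open>x = x'\<close> \<open>z = cmap d (p y')\<close> by blast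
    next
      fix w assume "w \<in> ?R"
      then obtain x where x: "x \<in> X" "p (f x) \<in> cdom d" "w = x @ cmap d (p (f x))" by blast
      then obtain c where c: "c \<in> C" "f x \<in> cdom c" using C(3) unfolding points_def by blast
      have "length x = m" using X x(1) definable_length by blast
      moreover have "length (cmap c (f x)) = cdim c" using length_cmap[OF E _ c(2)] c(1) C(2) by blast
      moreover have "length (cmap d (p (f x))) = cdim d" using length_cmap[OF B d x(2)] .
      moreover have "x @ cmap c (f x) \<in> ?f c" using x(1) c(2) by blast
      moreover have "cmap c (f x) @ cmap d (p (f x)) \<in> ?p c" using x(2) c(2) by blast
      ultimately have "w \<in> ?S c" unfolding x(3) by blast
      then show "w \<in> ?L" using c(1) by blast
    qed
    ultimately show ?thesis by simp
  qed
  ultimately show ?thesis unfolding ld_map_def_space[OF B] by blast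
qed

lemma ld_map_Un:
  assumes N: "locally_definable_space D N"
    and X: "closed_definable m X" and Y: "closed_definable m Y"
    and fX: "ld_map D (def_space m X) N f" and fY: "ld_map D (def_space m Y) N f"
  shows "ld_map D (def_space m (X \<union> Y)) N f"
  unfolding ld_map_def_space[OF N]
proof (intro conjI ballI)
  obtain C C' where "finite C" "C \<subseteq> N" "f ` X \<subseteq> points C" "finite C'" "C' \<subseteq> N" "f ` Y \<subseteq> points C'"
    using ld_map_finite_charts[OF N fX] ld_map_finite_charts[OF N fY] by blast
  then show "\<exists>C. finite C \<and> C \<subseteq> N \<and> f ` (X \<union> Y) \<subseteq> points C"
    by (intro exI[of _ "C \<union> C'"]) (auto simp: points_def)
next
  let ?T = "subtopology (Rn_top m) (X \<union> Y)"
  have "continuous_map (subtopology ?T S) (ld_top N) f" if "S \<in> {X, Y}" for S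
    using that ld_map_continuous[OF N fX] ld_map_continuous[OF N fY]
    by (auto simp: subtopology_subtopology Int_absorb1 Int_absorb2)
  moreover have "closedin ?T S" if "S \<in> {X, Y}" for S
    using that X Y unfolding closed_definable_def
    by (auto intro!: closedin_subset_topspace)
  ultimately show "continuous_map ?T (ld_top N) f"
    by (intro pasting_lemma_closed[of "{X, Y}" ?T "\<lambda>S. S" _ "\<lambda>_. f"]) auto
next
  fix d assume d: "d \<in> N"
  have "{x @ cmap d (f x) |x. x \<in> X \<union> Y \<and> f x \<in> cdom d} =
      {x @ cmap d (f x) |x. x \<in> X \<and> f x \<in> cdom d} \<union> {x @ cmap d (f x) |x. x \<in> Y \<and> f x \<in> cdom d}"
    by blast
  then show "{x @ cmap d (f x) |x. x \<in> X \<union> Y \<and> f x \<in> cdom d} \<in> D (m + cdim d)"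
    using ld_map_graph[OF N fX d] ld_map_graph[OF N fY d] definable_Un by simp
qed

end


section \<open>Cubes\<close>

text \<open>Integer multiples are repeated sums; this provides the factors 2 and 3 in the maps
  below.\<close>

lemma pl_scale_of_nat: "pl_fun m f \<Longrightarrow> pl_fun m (\<lambda>x. of_nat c * f x)"
proof (induction c)
  case (Suc c)
  then show ?case using pl_add[OF Suc.prems Suc.IH] by (simp add: algebra_simps)
qed (simp add: pl_const)

lemma pl_scale_numeral: "pl_fun m f \<Longrightarrow> pl_fun m (\<lambda>x. numeral w * f x)"
  using pl_scale_of_nat[of m f "numeral w"] by simp

lemma pl_uminus: "pl_fun m f \<Longrightarrow> pl_fun m (\<lambda>x. - f x)"
  using pl_diff[OF pl_const[of m 0]] by simp

lemmas pl_intros = pl_fun.intros pl_uminus pl_scale_numeral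

lemma pl_mapI:
  assumes "\<And>x. length x = m \<Longrightarrow> length (F x) = n"
    and "\<And>i. i < n \<Longrightarrow> \<exists>f. pl_fun m f \<and> (\<forall>x. length x = m \<longrightarrow> F x ! i = f x)"
  shows "pl_map m n F"
  unfolding pl_map_def Ball_def length_Rn image_subset_iff using assms by blast

lemma pl_map_map: "(\<And>i. i < n \<Longrightarrow> pl_fun m (f i)) \<Longrightarrow> pl_map m n (\<lambda>x. map (\<lambda>i. f i x) [0..<n])"
  by (rule pl_mapI) auto

lemma pl_map_id: "pl_map n n (\<lambda>x. x)"
  by (rule pl_mapI) (auto intro: pl_nth)

lemma pl_map_butlast: "pl_map (Suc n) n butlast"
proof (rule pl_mapI)
  show "\<exists>f. pl_fun (Suc n) f \<and> (\<forall>x. length x = Suc n \<longrightarrow> butlast x ! i = f x)" if "i < n" for i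
    using that by (intro exI[of _ "\<lambda>x. x ! i"]) (simp add: nth_butlast pl_nth)
qed simp

lemma pl_map_tl: "pl_map (Suc n) n tl"
proof (rule pl_mapI)
  show "\<exists>f. pl_fun (Suc n) f \<and> (\<forall>x. length x = Suc n \<longrightarrow> tl x ! i = f x)" if "i < n" for i
    using that by (intro exI[of _ "\<lambda>x. x ! Suc i"]) (simp add: nth_tl pl_nth)
qed simp

lemma pl_map_snoc:
  assumes "pl_map m n F" "pl_fun m f"
  shows "pl_map m (Suc n) (\<lambda>x. F x @ [f x])"
proof (rule pl_mapI)
  fix i assume "i < Suc n"
  show "\<exists>g. pl_fun m g \<and> (\<forall>x. length x = m \<longrightarrow> (F x @ [f x]) ! i = g x)"
  proof (cases "i < n")
    case True
    then obtain g where "pl_fun m g" "\<forall>x\<in>Rn m. F x ! i = g x"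
      using assms(1) unfolding pl_map_def by blast
    then show ?thesis
      using True pl_map_length[OF assms(1)] by (intro exI[of _ g]) (simp add: nth_append)
  next
    case False
    then show ?thesis using \<open>i < Suc n\<close> assms(2) pl_map_length[OF assms(1)]
      by (intro exI[of _ f]) (simp add: nth_append)
  qed
qed (use pl_map_length[OF assms(1)] in simp)

lemma pl_map_Cons:
  assumes "pl_map m n F" "pl_fun m f"
  shows "pl_map m (Suc n) (\<lambda>x. f x # F x)"
proof (rule pl_mapI)
  fix i assume i: "i < Suc n"
  show "\<exists>g. pl_fun m g \<and> (\<forall>x. length x = m \<longrightarrow> (f x # F x) ! i = g x)"
  proof (cases i)
    case 0
    then show ?thesis using assms(2) by auto
  next
    case (Suc j)
    then obtain g where "pl_fun m g" "\<forall>x\<in>Rn m. F x ! j = g x"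
      using assms(1) i unfolding pl_map_def by blast
    then show ?thesis using Suc by (intro exI[of _ g]) simp
  qed
qed (use pl_map_length[OF assms(1)] in simp)

lemma cube_iff: "t \<in> cube n \<longleftrightarrow> length t = n \<and> (\<forall>i<n. 0 \<le> t ! i \<and> t ! i \<le> 1)"
  by (simp add: cube_def)

text \<open>Homotopy time is the last entry of a list and the coordinate of juxtaposition the first,
  hence parallel rules for \<open>@\<close> and \<open>#\<close>.\<close>

lemma snoc_in_cube: "t @ [s] \<in> cube (Suc n) \<longleftrightarrow> t \<in> cube n \<and> 0 \<le> s \<and> s \<le> 1"
  by (auto simp: cube_iff nth_append less_Suc_eq)

lemma Cons_in_cube: "s # t \<in> cube (Suc n) \<longleftrightarrow> t \<in> cube n \<and> 0 \<le> s \<and> s \<le> 1"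
  by (auto simp: cube_iff nth_Cons' less_Suc_eq_0_disj)

lemma times_I_cube: "times_I (cube n) = cube (Suc n)"
proof (intro subset_antisym subsetI)
  fix z :: "'a list" assume "z \<in> times_I (cube n)"
  then show "z \<in> cube (Suc n)" by (auto simp: times_I_def snoc_in_cube)
next
  fix z :: "'a list" assume z: "z \<in> cube (Suc n)"
  then obtain t s where "z = t @ [s]" by (auto simp: cube_iff length_Suc_conv_rev)
  then show "z \<in> times_I (cube n)" using z by (auto simp: times_I_def snoc_in_cube)
qed

lemma cube_SucE:
  assumes "z \<in> cube (Suc n)"
  obtains t s where "z = t @ [s]" "t \<in> cube n" "0 \<le> s" "s \<le> 1"
  using assms unfolding times_I_cube[symmetric] times_I_def by auto

text \<open>All faces except \<open>t ! k = 0\<close>. The direction \<open>k\<close> is a parameter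
  because the box occurs twice with \<open>k = n - 1\<close>: in dimension \<open>n\<close>, where
  it is \<open>J\<^sup>n\<^sup>-\<^sup>1\<close>, and in dimension \<open>n + 1\<close>, where the
  last coordinate is the time of a homotopy and is not the free direction.\<close>

definition cube_box :: "nat \<Rightarrow> nat \<Rightarrow> 'r::linordered_field list set" where
  "cube_box k n = {t \<in> cube n. t ! k = 1 \<or> (\<exists>i<n. i \<noteq> k \<and> (t ! i = 0 \<or> t ! i = 1))}"

context ominimal_expansion
begin

lemma closed_definable_cube: "closed_definable n (cube n)"
proof -
  have "closed_definable n {x \<in> Rn n. \<forall>i\<in>{..<n}. x \<in> {x \<in> Rn n. 0 \<le> x ! i} \<inter> {x \<in> Rn n. x ! i \<le> 1}}"
    by (intro closed_definable_INT closed_definable_Int closed_definable_le pl_intros) auto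
  then show ?thesis by (rule back_subst[of "closed_definable n"]) (auto simp: cube_iff)
qed

lemma definable_cube: "cube n \<in> D n"
  using closed_definable_cube by (simp add: closed_definable_def)

lemma closed_definable_cube_box:
  assumes "k < n"
  shows "closed_definable n (cube_box k n)"
proof -
  have "closed_definable n (cube n \<inter> ({x \<in> Rn n. x ! k = 1} \<union>
      (\<Union>i\<in>{..<n} - {k}. {x \<in> Rn n. x ! i = 0} \<union> {x \<in> Rn n. x ! i = 1})))"
    using assms
    by (intro closed_definable_Int closed_definable_Un closed_definable_UN closed_definable_eq
        closed_definable_cube pl_intros) auto
  then show ?thesis
    by (rule back_subst[of "closed_definable n"]) (auto simp: cube_box_def cube_iff)
qed

text \<open>The closure restores those points of the free face that lie on another face as well:
  raising their last coordinate slightly leaves the free face but not the boundary.\<close>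

lemma cube_J_eq:
  assumes n: "1 \<le> n"
  shows "cube_J n = (cube_box (n - 1) n :: 'r list set)"
proof (intro subset_antisym subsetI)
  have "cube_boundary n - cube_face n \<subseteq> (cube_box (n - 1) n :: 'r list set)"
    by (auto simp: cube_boundary_def cube_face_def cube_box_def)
  moreover have "closedin (Rn_top n) (cube_box (n - 1) n :: 'r list set)"
    using closed_definable_cube_box[of "n - 1" n] n by (simp add: closed_definable_def)
  ultimately have "cube_J n \<subseteq> (cube_box (n - 1) n :: 'r list set)"
    unfolding cube_J_def by (rule closure_of_minimal)
  then show "t \<in> cube_box (n - 1) n" if "t \<in> cube_J n" for t :: "'r list" using that by blast
next
  fix t :: "'r list" assume t: "t \<in> cube_box (n - 1) n"
  then have len: "length t = n" and cube: "t \<in> cube n" by (auto simp: cube_box_def cube_iff)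
  show "t \<in> cube_J n"
    unfolding cube_J_def in_closure_of
  proof (intro conjI allI impI; (elim conjE)?)
    show "t \<in> topspace (Rn_top n)" using len by simp
    fix T assume T: "t \<in> T" "openin (Rn_top n) T"
    show "\<exists>y. y \<in> cube_boundary n - cube_face n \<and> y \<in> T"
    proof (cases "t ! (n - 1) = 0")
      case False
      then have "t \<in> cube_boundary n - cube_face n"
        using t n by (auto simp: cube_boundary_def cube_face_def cube_box_def intro: exI[of _ "n - 1"])
      then show ?thesis using T(1) by blast
    next
      case True
      then obtain i where i: "i < n" "i \<noteq> n - 1" "t ! i = 0 \<or> t ! i = 1"
        using t by (auto simp: cube_box_def)
      obtain e where e: "e > 0" "\<And>y. y \<in> Rn n \<Longrightarrow> \<forall>i<n. \<bar>y ! i - t ! i\<bar> < e \<Longrightarrow> y \<in> T"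
        using T unfolding openin_Rn_top Rn_open_def by blast
      \<comment> \<open>Positive to leave the face, at most 1 to stay in the cube, below
        \<open>e\<close> to stay in \<open>T\<close>.\<close>
      define d where "d = min 1 (e / 2)"
      have d: "0 < d" "d \<le> 1" "d < e" using e(1) by (auto simp: d_def min_less_iff_disj)
      define y where "y = t[n - 1 := d]"
      have y: "length y = n" "y ! (n - 1) = d" "\<And>j. j \<noteq> n - 1 \<Longrightarrow> y ! j = t ! j"
        using len n by (auto simp: y_def)
      have "y \<in> cube n"
        unfolding cube_iff
      proof (intro conjI allI impI y(1))
        fix j assume "j < n"
        show "0 \<le> y ! j" "y ! j \<le> 1"
          using y(2,3) d cube \<open>j < n\<close> by (cases "j = n - 1"; auto simp: cube_iff)+
      qed
      then have "y \<in> cube_boundary n - cube_face n"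
        using y i d unfolding cube_boundary_def cube_face_def by auto
      moreover have "y \<in> T"
      proof (rule e(2))
        show "\<forall>j<n. \<bar>y ! j - t ! j\<bar> < e"
        proof (intro allI impI)
          fix j
          show "\<bar>y ! j - t ! j\<bar> < e"
            using y(2,3) d True e(1) by (cases "j = n - 1") auto
        qed
      qed (simp add: y(1))
      ultimately show ?thesis by blast
    qed
  qed
qed

end

section \<open>Deforming a cube into a box\<close>

text \<open>Points are pushed towards the face \<open>t\<^sub>k = 1\<close> and, in the other coordinates, away from the
  centre of the cube; \<open>box_height_upto k n z\<close> is a time at which \<open>z\<close> is in the box, and it vanishes
  on the box.  With the factor 3, a point of height
  \<open>3 z\<^sub>i\<close> or \<open>3 - 3 z\<^sub>i\<close> is pushed to the face \<open>t\<^sub>i = 0\<close> or \<open>t\<^sub>i = 1\<close>.  All maps are piecewise linear, so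
  no definability or continuity of products of coordinates is needed.\<close>

primrec box_height_upto :: "nat \<Rightarrow> nat \<Rightarrow> 'r::linordered_field list \<Rightarrow> 'r" where
  "box_height_upto k 0 z = 1 - z ! k"
| "box_height_upto k (Suc j) z =
    (if j = k then box_height_upto k j z
     else min (box_height_upto k j z) (min (3 * z ! j) (3 - 3 * z ! j)))"

definition box_push :: "nat \<Rightarrow> nat \<Rightarrow> 'r::linordered_field \<Rightarrow> 'r list \<Rightarrow> 'r list" where
  "box_push k n s z = map (\<lambda>i. if i = k then z ! i + s
     else max 0 (min 1 (z ! i + max (- s) (min s (2 * z ! i - 1))))) [0..<n]"

lemma pl_box_height:
  "k < m \<Longrightarrow> j \<le> m \<Longrightarrow> pl_fun m (box_height_upto k j :: 'r::linordered_field list \<Rightarrow> 'r)"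
proof (induction j)
  case 0
  have "pl_fun m (\<lambda>z. 1 - z ! k :: 'r)" using 0 by (intro pl_intros) auto
  then show ?case by simp
next
  case (Suc j)
  have "pl_fun m (\<lambda>z. min (box_height_upto k j z) (min (3 * z ! j) (3 - 3 * z ! j)) :: 'r)"
    using Suc by (intro pl_intros) auto
  then show ?case using Suc by (cases "j = k") auto
qed

text \<open>Allows the height to be evaluated at a point \<open>z @ [t]\<close> of the cylinder,
  where it ignores the time.\<close>

lemma box_height_append: "k < n \<Longrightarrow> length z = n \<Longrightarrow> j \<le> n \<Longrightarrow>
    box_height_upto k j (z @ w) = box_height_upto k j z"
  by (induction j) (auto simp: nth_append)

lemma box_height_le:
  "box_height_upto k j z \<le> 1 - z ! k"
  "i < j \<Longrightarrow> i \<noteq> k \<Longrightarrow> box_height_upto k j z \<le> 3 * z ! i \<and> box_height_upto k j z \<le> 3 - 3 * z ! i"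
  by (induction j) (auto simp: less_Suc_eq min_le_iff_disj)

lemma box_height_nonneg: "z \<in> cube n \<Longrightarrow> k < n \<Longrightarrow> j \<le> n \<Longrightarrow> 0 \<le> box_height_upto k j z"
  by (induction j) (auto simp: cube_iff)

lemma box_height_cases:
  "box_height_upto k j z = 1 - z ! k \<or> (\<exists>i<j. i \<noteq> k \<and>
    (box_height_upto k j z = 3 * z ! i \<or> box_height_upto k j z = 3 - 3 * z ! i))"
  by (induction j) (auto simp: min_def less_Suc_eq)

text \<open>On each face of the box one term of the minimum vanishes, and on the cube no term is
  negative.\<close>

lemma box_height_box:
  assumes "z \<in> cube_box k n" "k < n"
  shows "box_height_upto k n z = 0"
proof (rule antisym)
  show "0 \<le> box_height_upto k n z" using assms box_height_nonneg by (auto simp: cube_box_def)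
  show "box_height_upto k n z \<le> 0"
    using assms(1) box_height_le(1)[of k n z] box_height_le(2)[of _ n k z]
    by (fastforce simp: cube_box_def)
qed

lemma box_push_0: "z \<in> cube n \<Longrightarrow> box_push k n 0 z = z"
  by (rule nth_equalityI) (auto simp: box_push_def cube_iff)

text \<open>Coordinate \<open>k\<close> is moved without clamping, which is why \<open>s\<close> is
  bounded by \<open>1 - z ! k\<close>; the other coordinates are clamped to the unit
  interval.\<close>

lemma box_push_in_cube:
  assumes "z \<in> cube n" "0 \<le> s" "s \<le> 1 - z ! k" "k < n"
  shows "box_push k n s z \<in> cube n"
  using assms by (auto simp: box_push_def cube_iff)

lemma box_push_in_box:
  assumes z: "z \<in> cube n" and k: "k < n"
  shows "box_push k n (box_height_upto k n z) z \<in> cube_box k n"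
proof -
  define s where "s = box_height_upto k n z"
  have s: "0 \<le> s" "s \<le> 1 - z ! k" "s \<le> 1"
    using box_height_nonneg[OF z k] box_height_le(1)[of k n z] z k by (auto simp: s_def cube_iff)
  have "box_push k n s z \<in> cube n" using box_push_in_cube z s k by blast
  moreover consider "s = 1 - z ! k" | i where "i < n" "i \<noteq> k" "s = 3 * z ! i"
    | i where "i < n" "i \<noteq> k" "s = 3 - 3 * z ! i"
    using box_height_cases[of k n z] by (auto simp: s_def)
  then have "box_push k n s z ! k = 1 \<or>
      (\<exists>i<n. i \<noteq> k \<and> (box_push k n s z ! i = 0 \<or> box_push k n s z ! i = 1))"
  proof cases
    case 1
    then show ?thesis using k by (simp add: box_push_def)
  next
    case (2 i)
    \<comment> \<open>The displacement is at most \<open>- (z ! i)\<close>: on the one hand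
      \<open>- s = - 3 * z ! i\<close>; on the other hand \<open>s \<le> 1\<close> forces
      \<open>z ! i \<le> 1/3\<close>, that is, \<open>2 * z ! i - 1 \<le> - (z ! i)\<close>. The
      second estimate is where the factor 3 is used.\<close>
    have "z ! i + max (- s) (min s (2 * z ! i - 1)) \<le> 0"
      using 2(3) s by (simp add: max_def min_def)
    then have "box_push k n s z ! i = 0" using 2 by (simp add: box_push_def)
    then show ?thesis using 2 by blast
  next
    case (3 i)
    \<comment> \<open>The mirror image under exchanging \<open>z ! i\<close> and
      \<open>1 - z ! i\<close>; now \<open>z ! i \<ge> 2/3\<close>.\<close>
    have "z ! i + max (- s) (min s (2 * z ! i - 1)) \<ge> 1"
      using 3(3) s by (simp add: max_def min_def)
    then have "box_push k n s z ! i = 1" using 3 by (simp add: box_push_def)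
    then show ?thesis using 3 by blast
  qed
  ultimately show ?thesis by (simp add: cube_box_def s_def)
qed

context ominimal_expansion
begin

lemma serre_fibration_box_lift:
  fixes f :: "'r list \<Rightarrow> 'e" and G :: "'r list \<Rightarrow> 'b"
  assumes E: "locally_definable_space D E" and B: "locally_definable_space D B"
    and p: "serre_fibration D E B p" and k: "k < n"
    and f: "ld_map D (def_space n (cube_box k n)) E f"
    and G: "ld_map D (def_space n (cube n)) B G"
    and pf: "\<And>z. z \<in> cube_box k n \<Longrightarrow> p (f z) = G z"
  obtains g where "ld_map D (def_space n (cube n)) E g"
    "\<And>z. z \<in> cube n \<Longrightarrow> p (g z) = G z" "\<And>z. z \<in> cube_box k n \<Longrightarrow> g z = f z"
proof -
  define h :: "'r list \<Rightarrow> 'r" where "h = box_height_upto k n"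
  \<comment> \<open>The difference \<open>h w - w ! n\<close> is the amount of pushing left at time
    \<open>w ! n\<close>: all of it at time 0, none at time \<open>h w\<close>. Cutting it off at 0
    continues the deformation constantly, so that it lives on the whole cylinder.\<close>
  define K where "K w = box_push k n (max (h w - w ! n) 0) w" for w
  have h: "pl_fun n h" "pl_fun (Suc n) h" using k by (auto simp: h_def intro!: pl_box_height)
  have K: "pl_map (Suc n) n K" unfolding K_def box_push_def
  proof (rule pl_map_map)
    fix i assume i: "i < n"
    show "pl_fun (Suc n) (\<lambda>w. if i = k then w ! i + max (h w - w ! n) 0
      else max 0 (min 1 (w ! i + max (- max (h w - w ! n) 0) (min (max (h w - w ! n) 0) (2 * w ! i - 1)))))"
      using i h by (cases "i = k") (auto intro!: pl_intros)
  qed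
  \<comment> \<open>The bounds 0 and 1 place the graph of \<open>h\<close> inside the cylinder; the
    bound \<open>1 - z ! k\<close> makes the push stay in the cube.\<close>
  have hz: "0 \<le> h z" "h z \<le> 1 - z ! k" "h z \<le> 1" if "z \<in> cube n" for z
    using box_height_nonneg[OF that k] box_height_le(1)[of k n z] that k
    by (auto simp: h_def cube_iff)
  have K_snoc: "K (z @ [t]) = box_push k n (max (h z - t) 0) z" if "z \<in> cube n" for z t
    using that k by (auto simp: K_def h_def box_push_def cube_iff box_height_append nth_append)
  have K_cube: "K w \<in> cube n" if "w \<in> cube (Suc n)" for w
  proof -
    obtain z t where w: "w = z @ [t]" and zt: "z \<in> cube n" "0 \<le> t"
      using \<open>w \<in> cube (Suc n)\<close> by (rule cube_SucE)
    show ?thesis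
      unfolding w K_snoc[OF zt(1)] using hz[OF zt(1)] zt(2) by (intro box_push_in_cube zt k) auto
  qed
  have K_0: "K (z @ [0]) \<in> cube_box k n" if "z \<in> cube n" for z
    using box_push_in_box[OF that k] K_snoc[OF that] hz[OF that] by (simp add: h_def max_absorb1)
  have K_h: "K (z @ [h z]) = z" if "z \<in> cube n" for z
    using box_push_0[OF that] K_snoc[OF that] by simp
  \<comment> \<open>Since \<open>f\<close> is given on the box only, \<open>f \<circ> K\<close> is
    formed on the bottom face \<open>Y\<close> of the cylinder, which \<open>K\<close> maps into the
    box. The initial map of the homotopy then arises by a second reparametrisation, from the cube to
    \<open>Y\<close>.\<close>
  define Y where "Y = cube (Suc n) \<inter> {w \<in> Rn (Suc n). w ! n = (0::'r)}"
  have "closed_definable (Suc n) Y"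
    unfolding Y_def
    by (intro closed_definable_Int closed_definable_cube closed_definable_eq pl_intros) auto
  then have Y: "Y \<in> D (Suc n)" by (simp add: closed_definable_def)
  have "K ` Y \<subseteq> cube_box k n"
  proof (intro subsetI, elim imageE)
    fix z w assume w: "w \<in> Y" "z = K w"
    then obtain v s where v: "w = v @ [s]" "v \<in> cube n"
      unfolding Y_def by (blast elim: cube_SucE)
    then have "s = 0" using w(1) by (simp add: Y_def cube_iff nth_append)
    with v show "z \<in> cube_box k n" using K_0 w(2) by simp
  qed
  from ld_map_pl_comp[OF E f K Y this] have fK: "ld_map D (def_space (Suc n) Y) E (\<lambda>w. f (K w))" .
  have "(\<lambda>z. z @ [0]) ` cube n \<subseteq> Y"
    by (auto simp: Y_def snoc_in_cube cube_iff nth_append)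
  from ld_map_pl_comp[OF E fK pl_map_snoc[OF pl_map_id pl_const] definable_cube this]
  have fr: "ld_map D (def_space n (cube n)) E (\<lambda>z. f (K (z @ [0])))" .
  have GK: "ld_map D (def_space (Suc n) (times_I (cube n))) B (\<lambda>w. G (K w))"
    unfolding times_I_cube
    by (rule ld_map_pl_comp[OF B G K definable_cube]) (use K_cube in blast)
  have "closedin (Rn_top n) (cube n :: 'r list set)" "bounded_Rn n (cube n :: 'r list set)"
    using closed_definable_cube
    by (auto simp: closed_definable_def bounded_Rn_def cube_iff intro!: exI[of _ 1])
  moreover have "\<forall>z\<in>cube n. G (K (z @ [0])) = p (f (K (z @ [0])))"
    using pf K_0 by simp
  ultimately obtain H where H: "ld_map D (def_space (Suc n) (times_I (cube n))) E H"
      "\<forall>w\<in>times_I (cube n). p (H w) = G (K w)" "\<forall>z\<in>cube n. H (z @ [0]) = f (K (z @ [0]))"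
    using p[unfolded serre_fibration_def, THEN conjunct2, rule_format,
        of "cube n" n "\<lambda>z. f (K (z @ [0]))" "\<lambda>w. G (K w)"] fr GK definable_cube
    by blast
  have graph: "z @ [h z] \<in> cube (Suc n)" if "z \<in> cube n" for z
    using that hz[OF that] by (simp add: snoc_in_cube)
  show thesis
  proof (rule that)
    show "ld_map D (def_space n (cube n)) E (\<lambda>z. H (z @ [h z]))"
      using graph
      by (intro ld_map_pl_comp[OF E H(1)[unfolded times_I_cube] pl_map_snoc[OF pl_map_id h(1)]]
          definable_cube) blast
    show "p (H (z @ [h z])) = G z" if "z \<in> cube n" for z
      using H(2) graph[OF that] K_h[OF that] by (simp add: times_I_cube)
    show "H (z @ [h z]) = f z" if z: "z \<in> cube_box k n" for z
    proof -
      have cube: "z \<in> cube n" using z by (simp add: cube_box_def)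
      have "h z = 0" using box_height_box[OF z k] by (simp add: h_def)
      then show ?thesis using H(3) K_h[OF cube] cube by simp
    qed
  qed
qed

end


section \<open>Homotopies\<close>

lemma cube_length: "t \<in> cube n \<Longrightarrow> length t = n"
  by (simp add: cube_iff)

lemma cube_boundary_Cons:
  "a # u \<in> cube_boundary (Suc m) \<longleftrightarrow>
    a # u \<in> cube (Suc m) \<and> (a = 0 \<or> a = 1 \<or> (\<exists>i<m. u ! i = 0 \<or> u ! i = 1))"
  unfolding cube_boundary_def less_Suc_eq_0_disj by auto

lemma juxtapose_Cons:
  "juxtapose f g (a # u) = (if a \<le> 1/2 then f (2 * a # u) else g ((2 * a - 1) # u))"
  by (simp add: juxtapose_def)

lemma comp_juxtapose: "p \<circ> juxtapose f g = juxtapose (p \<circ> f) (p \<circ> g)"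
  by (simp add: fun_eq_iff juxtapose_def)

lemma cube_ConsE:
  assumes "z \<in> cube (Suc n)"
  obtains a u where "z = a # u" "u \<in> cube n" "0 \<le> a" "a \<le> 1"
  using assms by (cases z) (auto simp: Cons_in_cube, simp add: cube_iff)

lemma cube_boundary_subset: "cube_boundary n \<subseteq> cube n"
  by (auto simp: cube_boundary_def)

lemma cube_box_subset_boundary: "k < n \<Longrightarrow> cube_box k n \<subseteq> cube_boundary n"
  by (auto simp: cube_box_def cube_boundary_def)

context ominimal_expansion
begin

lemma ld_map_glue:
  assumes N: "locally_definable_space D N"
    and X: "closed_definable m X" and Y: "closed_definable m Y"
    and f: "ld_map D (def_space m X) N f" and g: "ld_map D (def_space m Y) N g"
    and "\<And>x. x \<in> X \<Longrightarrow> h x = f x" and "\<And>x. x \<in> Y \<Longrightarrow> h x = g x"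
  shows "ld_map D (def_space m (X \<union> Y)) N h"
proof (rule ld_map_Un[OF N X Y])
  show "ld_map D (def_space m X) N h" using f ld_map_cong[of X h f] assms(6) by blast
  show "ld_map D (def_space m Y) N h" using g ld_map_cong[of Y h g] assms(7) by blast
qed

lemma ld_map_juxtapose:
  assumes N: "locally_definable_space D N"
    and f: "ld_map D (def_space (Suc m) (cube (Suc m))) N f"
    and g: "ld_map D (def_space (Suc m) (cube (Suc m))) N g"
    and fg: "\<And>u. u \<in> cube m \<Longrightarrow> f (1 # u) = g (0 # u)"
  shows "ld_map D (def_space (Suc m) (cube (Suc m))) N (juxtapose f g)"
proof -
  let ?X = "(cube (Suc m) :: 'r list set) \<inter> {x \<in> Rn (Suc m). x ! 0 \<le> 1/2}"
    and ?Y = "(cube (Suc m) :: 'r list set) \<inter> {x \<in> Rn (Suc m). 1/2 \<le> x ! 0}"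
  have X: "closed_definable (Suc m) ?X" and Y: "closed_definable (Suc m) ?Y"
    by (intro closed_definable_Int closed_definable_cube closed_definable_le pl_intros; simp)+
  have "ld_map D (def_space (Suc m) (?X \<union> ?Y)) N (juxtapose f g)"
  proof (rule ld_map_glue[OF N X Y])
    show "ld_map D (def_space (Suc m) ?X) N (\<lambda>x. f (2 * x ! 0 # tl x))"
    proof (rule ld_map_pl_comp[OF N f])
      show "pl_map (Suc m) (Suc m) (\<lambda>x. 2 * x ! 0 # tl x)"
        by (intro pl_map_Cons pl_map_tl pl_intros) simp
      show "(\<lambda>x. 2 * x ! 0 # tl x) ` ?X \<subseteq> cube (Suc m)"
        by (auto simp: Cons_in_cube elim!: cube_ConsE)
    qed (use X in \<open>simp add: closed_definable_def\<close>)
    show "ld_map D (def_space (Suc m) ?Y) N (\<lambda>x. g ((2 * x ! 0 - 1) # tl x))"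
    proof (rule ld_map_pl_comp[OF N g])
      show "pl_map (Suc m) (Suc m) (\<lambda>x. (2 * x ! 0 - 1) # tl x)"
        by (intro pl_map_Cons pl_map_tl pl_intros) simp
      show "(\<lambda>x. (2 * x ! 0 - 1) # tl x) ` ?Y \<subseteq> cube (Suc m)"
        by (auto simp: Cons_in_cube elim!: cube_ConsE)
    qed (use Y in \<open>simp add: closed_definable_def\<close>)
    show "juxtapose f g x = f (2 * x ! 0 # tl x)" if "x \<in> ?X" for x
      using that by (auto simp: juxtapose_Cons elim!: cube_ConsE)
    show "juxtapose f g x = g ((2 * x ! 0 - 1) # tl x)" if "x \<in> ?Y" for x
    proof -
      have "x \<in> cube (Suc m)" using that by blast
      then obtain a u where x: "x = a # u" "u \<in> cube m" by (rule cube_ConsE)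
      show ?thesis
      \<comment> \<open>At the seam \<open>juxtapose\<close> takes its first branch, at
        \<open>1 # u\<close>, while the formula for \<open>?Y\<close> gives \<open>g\<close> at
        \<open>0 # u\<close>.\<close>
      proof (cases "a = 1/2")
        case True
        then have [simp]: "2 * a = 1" "a \<le> 1/2" by simp_all
        show ?thesis using x fg[OF x(2)] by (simp add: juxtapose_Cons)
      next
        case False
        then show ?thesis using x that by (simp add: juxtapose_Cons)
      qed
    qed
  qed
  moreover have "?X \<union> ?Y = cube (Suc m)" by (auto simp: cube_iff)
  ultimately show ?thesis by simp
qed

section \<open>Homotopy relative to the boundary is an equivalence relation\<close>

lemma abs_homotopicI:
  assumes "f \<in> abs_maps D n X x0" "g \<in> abs_maps D n X x0"
    and "ld_map D (def_space (Suc n) (cube (Suc n))) X H"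
    and "\<And>t s. t \<in> cube_boundary n \<Longrightarrow> 0 \<le> s \<Longrightarrow> s \<le> 1 \<Longrightarrow> H (t @ [s]) = f t"
    and "\<And>t. t \<in> cube n \<Longrightarrow> H (t @ [0]) = f t" "\<And>t. t \<in> cube n \<Longrightarrow> H (t @ [1]) = g t"
  shows "(f, g) \<in> abs_homotopic D n X x0"
  using assms unfolding abs_homotopic_def times_I_cube by auto

text \<open>Boundary values are delivered as \<open>x0\<close> instead of \<open>f t\<close>, which
  agree for \<open>f\<close> in \<open>abs_maps\<close>; in this form they suit both ends, as
  reversal and concatenation require.\<close>

lemma abs_homotopicE:
  assumes "(f, g) \<in> abs_homotopic D n X x0"
  obtains H where "f \<in> abs_maps D n X x0" "g \<in> abs_maps D n X x0"
    "ld_map D (def_space (Suc n) (cube (Suc n))) X H"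
    "\<And>t s. t \<in> cube_boundary n \<Longrightarrow> 0 \<le> s \<Longrightarrow> s \<le> 1 \<Longrightarrow> H (t @ [s]) = x0"
    "\<And>t. t \<in> cube n \<Longrightarrow> H (t @ [0]) = f t" "\<And>t. t \<in> cube n \<Longrightarrow> H (t @ [1]) = g t"
proof -
  obtain H where H: "f \<in> abs_maps D n X x0" "g \<in> abs_maps D n X x0"
    "ld_map D (def_space (Suc n) (times_I (cube n))) X H"
    "\<forall>t\<in>cube_boundary n. \<forall>s\<in>{0..1}. H (t @ [s]) = f t"
    "\<forall>t\<in>cube n. H (t @ [0]) = f t \<and> H (t @ [1]) = g t"
    using assms unfolding abs_homotopic_def by blast
  moreover have "f t = x0" if "t \<in> cube_boundary n" for t
    using H(1) that unfolding abs_maps_def by blast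
  ultimately show thesis using that[of H] unfolding times_I_cube by simp
qed

lemma abs_maps_boundary: "f \<in> abs_maps D n X x0 \<Longrightarrow> t \<in> cube_boundary n \<Longrightarrow> f t = x0"
  unfolding abs_maps_def by blast

text \<open>The constant homotopy. Besides reflexivity this absorbs the arbitrary values of maps
  outside the cube.\<close>

lemma abs_homotopic_cong:
  assumes X: "locally_definable_space D X" and f: "f \<in> abs_maps D n X x0"
    and fg: "\<And>t. t \<in> cube n \<Longrightarrow> f t = g t"
  shows "(f, g) \<in> abs_homotopic D n X x0"
proof (rule abs_homotopicI[OF f])
  have "g t = x0" if "t \<in> cube_boundary n" for t
    using abs_maps_boundary[OF f that] fg[of t] subsetD[OF cube_boundary_subset that] by simp
  then show "g \<in> abs_maps D n X x0"
    using f ld_map_cong[of "cube n" f g n] fg unfolding abs_maps_def by auto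
  have "ld_map D (def_space n (cube n)) X f" using f unfolding abs_maps_def by blast
  then show "ld_map D (def_space (Suc n) (cube (Suc n))) X (\<lambda>w. f (butlast w))"
    by (rule ld_map_pl_comp[OF X _ pl_map_butlast definable_cube]) (auto elim!: cube_SucE)
qed (use fg in auto)

lemma abs_homotopic_sym:
  assumes X: "locally_definable_space D X" and "(f, g) \<in> abs_homotopic D n X x0"
  shows "(g, f) \<in> abs_homotopic D n X x0"
  using assms(2)
proof (rule abs_homotopicE)
  fix H
  assume f: "f \<in> abs_maps D n X x0" and g: "g \<in> abs_maps D n X x0"
    and ld: "ld_map D (def_space (Suc n) (cube (Suc n))) X H"
    and bd: "\<And>t s. t \<in> cube_boundary n \<Longrightarrow> 0 \<le> s \<Longrightarrow> s \<le> 1 \<Longrightarrow> H (t @ [s]) = x0"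
    and H: "\<And>t. t \<in> cube n \<Longrightarrow> H (t @ [0]) = f t" "\<And>t. t \<in> cube n \<Longrightarrow> H (t @ [1]) = g t"
  show ?thesis
  proof (rule abs_homotopicI[OF g f])
    show "ld_map D (def_space (Suc n) (cube (Suc n))) X (\<lambda>w. H (butlast w @ [1 - w ! n]))"
    proof (rule ld_map_pl_comp[OF X ld _ definable_cube])
      show "pl_map (Suc n) (Suc n) (\<lambda>w. butlast w @ [1 - w ! n])"
        by (intro pl_map_snoc pl_map_butlast pl_intros) simp
      show "(\<lambda>w. butlast w @ [1 - w ! n]) ` cube (Suc n) \<subseteq> cube (Suc n)"
        by (auto simp: snoc_in_cube nth_append cube_length elim!: cube_SucE)
    qed
    fix t :: "'r list" and s :: 'r
    assume t: "t \<in> cube_boundary n" and s: "0 \<le> s" "s \<le> 1"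
    have "length t = n" using t cube_boundary_subset cube_length by blast
    then show "H (butlast (t @ [s]) @ [1 - (t @ [s]) ! n]) = g t"
      using bd[OF t, of "1 - s"] s abs_maps_boundary[OF g t] by (simp add: nth_append)
  qed (use H cube_length in \<open>auto simp: nth_append\<close>)
qed

lemma abs_homotopic_trans:
  assumes X: "locally_definable_space D X"
    and fg: "(f, g) \<in> abs_homotopic D n X x0" and gh: "(g, h) \<in> abs_homotopic D n X x0"
  shows "(f, h) \<in> abs_homotopic D n X x0"
proof -
  obtain H where f: "f \<in> abs_maps D n X x0"
    and H: "ld_map D (def_space (Suc n) (cube (Suc n))) X H"
    "\<And>t s. t \<in> cube_boundary n \<Longrightarrow> 0 \<le> s \<Longrightarrow> s \<le> 1 \<Longrightarrow> H (t @ [s]) = x0"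
    "\<And>t. t \<in> cube n \<Longrightarrow> H (t @ [0]) = f t" "\<And>t. t \<in> cube n \<Longrightarrow> H (t @ [1]) = g t"
    using fg by (elim abs_homotopicE) blast
  obtain K where h: "h \<in> abs_maps D n X x0"
    and K: "ld_map D (def_space (Suc n) (cube (Suc n))) X K"
    "\<And>t s. t \<in> cube_boundary n \<Longrightarrow> 0 \<le> s \<Longrightarrow> s \<le> 1 \<Longrightarrow> K (t @ [s]) = x0"
    "\<And>t. t \<in> cube n \<Longrightarrow> K (t @ [0]) = g t" "\<And>t. t \<in> cube n \<Longrightarrow> K (t @ [1]) = h t"
    using gh by (elim abs_homotopicE) blast
  \<comment> \<open>Concatenation in the last entry, the time; \<open>juxtapose\<close> acts on the
    first one.\<close>
  define L where "L w = (if w ! n \<le> 1/2 then H (butlast w @ [2 * w ! n])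
    else K (butlast w @ [2 * w ! n - 1]))" for w
  have L: "L (t @ [s]) = (if s \<le> 1/2 then H (t @ [2 * s]) else K (t @ [2 * s - 1]))"
    if "t \<in> cube n" for t s
    using cube_length[OF that] by (simp add: L_def nth_append)
  let ?X = "(cube (Suc n) :: 'r list set) \<inter> {x \<in> Rn (Suc n). x ! n \<le> 1/2}"
    and ?Y = "(cube (Suc n) :: 'r list set) \<inter> {x \<in> Rn (Suc n). 1/2 \<le> x ! n}"
  have cX: "closed_definable (Suc n) ?X" and cY: "closed_definable (Suc n) ?Y"
    by (intro closed_definable_Int closed_definable_cube closed_definable_le pl_intros; simp)+
  have "ld_map D (def_space (Suc n) (?X \<union> ?Y)) X L"
  proof (rule ld_map_glue[OF X cX cY])
    show "ld_map D (def_space (Suc n) ?X) X (\<lambda>w. H (butlast w @ [2 * w ! n]))"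
    proof (rule ld_map_pl_comp[OF X H(1)])
      show "pl_map (Suc n) (Suc n) (\<lambda>w. butlast w @ [2 * w ! n])"
        by (intro pl_map_snoc pl_map_butlast pl_intros) simp
      show "(\<lambda>w. butlast w @ [2 * w ! n]) ` ?X \<subseteq> cube (Suc n)"
        by (auto simp: snoc_in_cube nth_append cube_length elim!: cube_SucE)
    qed (use cX in \<open>simp add: closed_definable_def\<close>)
    show "ld_map D (def_space (Suc n) ?Y) X (\<lambda>w. K (butlast w @ [2 * w ! n - 1]))"
    proof (rule ld_map_pl_comp[OF X K(1)])
      show "pl_map (Suc n) (Suc n) (\<lambda>w. butlast w @ [2 * w ! n - 1])"
        by (intro pl_map_snoc pl_map_butlast pl_intros) simp
      show "(\<lambda>w. butlast w @ [2 * w ! n - 1]) ` ?Y \<subseteq> cube (Suc n)"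
        by (auto simp: snoc_in_cube nth_append cube_length elim!: cube_SucE)
    qed (use cY in \<open>simp add: closed_definable_def\<close>)
    show "L w = H (butlast w @ [2 * w ! n])" if "w \<in> ?X" for w
      using that by (simp add: L_def)
    show "L w = K (butlast w @ [2 * w ! n - 1])" if "w \<in> ?Y" for w
    proof -
      have "w \<in> cube (Suc n)" using that by blast
      then obtain t s where w: "w = t @ [s]" "t \<in> cube n" by (rule cube_SucE)
      then have s: "w ! n = s" "1/2 \<le> s" using that cube_length by (auto simp: nth_append)
      show ?thesis
      \<comment> \<open>At the seam one formula gives \<open>H\<close> at time 1 and the other
        \<open>K\<close> at time 0, and both are \<open>g\<close>.\<close>
      proof (cases "s = 1/2")
        case True
        then have [simp]: "2 * s = 1" "s \<le> 1/2" by simp_all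
        show ?thesis using L[OF w(2), of s] w s(1) H(4) K(3) by simp
      next
        case False
        then show ?thesis using L[OF w(2), of s] w s by simp
      qed
    qed
  qed
  moreover have "?X \<union> ?Y = cube (Suc n)" by (auto simp: cube_iff)
  ultimately have ld: "ld_map D (def_space (Suc n) (cube (Suc n))) X L" by simp
  show ?thesis
  proof (rule abs_homotopicI[OF f h ld])
    fix t :: "'r list" and s :: 'r
    assume t: "t \<in> cube_boundary n" and s: "0 \<le> s" "s \<le> 1"
    have "t \<in> cube n" using t cube_boundary_subset by blast
    then show "L (t @ [s]) = f t"
      using L[of t s] s H(2)[OF t] K(2)[OF t] abs_maps_boundary[OF f t] by simp
  qed (use L H K in auto)
qed

lemma equiv_abs_homotopic:
  assumes X: "locally_definable_space D X"
  shows "equiv (abs_maps D n X x0) (abs_homotopic D n X x0)"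
proof (rule equivI)
  show "abs_homotopic D n X x0 \<subseteq> abs_maps D n X x0 \<times> abs_maps D n X x0"
    by (auto simp: abs_homotopic_def)
  show "refl_on (abs_maps D n X x0) (abs_homotopic D n X x0)"
    by (auto intro!: refl_onI abs_homotopic_cong[OF X])
  show "sym (abs_homotopic D n X x0)" by (auto intro!: symI abs_homotopic_sym[OF X])
  show "trans (abs_homotopic D n X x0)" by (auto intro!: transI intro: abs_homotopic_trans[OF X])
qed

section \<open>Juxtaposition of absolute maps and of their homotopies\<close>

lemma juxtapose_abs_maps:
  assumes X: "locally_definable_space D X"
    and f: "f \<in> abs_maps D (Suc m) X x0" and g: "g \<in> abs_maps D (Suc m) X x0"
  shows "juxtapose f g \<in> abs_maps D (Suc m) X x0"
proof -
  have "f (1 # u) = g (0 # u)" if "u \<in> cube m" for u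
    using abs_maps_boundary[OF f, of "1 # u"] abs_maps_boundary[OF g, of "0 # u"] that
    by (simp add: cube_boundary_Cons Cons_in_cube)
  then have "ld_map D (def_space (Suc m) (cube (Suc m))) X (juxtapose f g)"
    using f g by (intro ld_map_juxtapose X) (auto simp: abs_maps_def)
  moreover have "juxtapose f g t = x0" if t: "t \<in> cube_boundary (Suc m)" for t
  proof -
    obtain a u where au: "t = a # u" "u \<in> cube m" "0 \<le> a" "a \<le> 1"
      using t cube_boundary_subset by (blast elim: cube_ConsE)
    then have "a \<le> 1/2 \<Longrightarrow> 2 * a # u \<in> cube_boundary (Suc m)"
        "\<not> a \<le> 1/2 \<Longrightarrow> (2 * a - 1) # u \<in> cube_boundary (Suc m)"
      using t by (auto simp: cube_boundary_Cons Cons_in_cube)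
    then show ?thesis
      using abs_maps_boundary[OF f] abs_maps_boundary[OF g] au(1) by (simp add: juxtapose_Cons)
  qed
  ultimately show ?thesis by (auto simp: abs_maps_def)
qed

text \<open>In dimension \<open>Suc m\<close> the head of a list is not the time entry, so
  \<open>juxtapose\<close>, applied to the two homotopies themselves, leaves the time alone and
  yields the required homotopy.\<close>

lemma juxtapose_abs_homotopic:
  assumes X: "locally_definable_space D X"
    and ff': "(f, f') \<in> abs_homotopic D (Suc m) X x0" and gg': "(g, g') \<in> abs_homotopic D (Suc m) X x0"
  shows "(juxtapose f g, juxtapose f' g') \<in> abs_homotopic D (Suc m) X x0"
proof -
  obtain H where f: "f \<in> abs_maps D (Suc m) X x0" "f' \<in> abs_maps D (Suc m) X x0"
    and H: "ld_map D (def_space (Suc (Suc m)) (cube (Suc (Suc m)))) X H"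
    "\<And>t s. t \<in> cube_boundary (Suc m) \<Longrightarrow> 0 \<le> s \<Longrightarrow> s \<le> 1 \<Longrightarrow> H (t @ [s]) = x0"
    "\<And>t. t \<in> cube (Suc m) \<Longrightarrow> H (t @ [0]) = f t" "\<And>t. t \<in> cube (Suc m) \<Longrightarrow> H (t @ [1]) = f' t"
    using ff' by (elim abs_homotopicE) blast
  obtain K where g: "g \<in> abs_maps D (Suc m) X x0" "g' \<in> abs_maps D (Suc m) X x0"
    and K: "ld_map D (def_space (Suc (Suc m)) (cube (Suc (Suc m)))) X K"
    "\<And>t s. t \<in> cube_boundary (Suc m) \<Longrightarrow> 0 \<le> s \<Longrightarrow> s \<le> 1 \<Longrightarrow> K (t @ [s]) = x0"
    "\<And>t. t \<in> cube (Suc m) \<Longrightarrow> K (t @ [0]) = g t" "\<And>t. t \<in> cube (Suc m) \<Longrightarrow> K (t @ [1]) = g' t"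
    using gg' by (elim abs_homotopicE) blast
  note fg = juxtapose_abs_maps[OF X f(1) g(1)]
  have snoc: "juxtapose H K ((a # u) @ [s]) =
      (if a \<le> 1/2 then H ((2 * a # u) @ [s]) else K (((2 * a - 1) # u) @ [s]))" for a u s
    by (simp add: juxtapose_Cons)
  show ?thesis
  proof (rule abs_homotopicI[OF fg juxtapose_abs_maps[OF X f(2) g(2)]])
    \<comment> \<open>Both sides are \<open>x0\<close>: a head equal to 1 or 0 is a boundary point,
      where the homotopies are stationary.\<close>
    have "H (1 # w) = K (0 # w)" if "w \<in> cube (Suc m)" for w
    proof -
      obtain u s where w: "w = u @ [s]" "u \<in> cube m" "0 \<le> s" "s \<le> 1"
        using \<open>w \<in> cube (Suc m)\<close> by (rule cube_SucE)
      have "1 # u \<in> cube_boundary (Suc m)" "0 # u \<in> cube_boundary (Suc m)"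
        using w(2) by (simp_all add: cube_boundary_Cons Cons_in_cube)
      then show ?thesis using H(2)[of "1 # u" s] K(2)[of "0 # u" s] w by simp
    qed
    then show "ld_map D (def_space (Suc (Suc m)) (cube (Suc (Suc m)))) X (juxtapose H K)"
      by (intro ld_map_juxtapose X H(1) K(1))
    fix t :: "'r list" assume "t \<in> cube (Suc m)"
    then obtain a u where t: "t = a # u" "u \<in> cube m" "0 \<le> a" "a \<le> 1" by (rule cube_ConsE)
    have "a \<le> 1/2 \<Longrightarrow> 2 * a # u \<in> cube (Suc m)" "\<not> a \<le> 1/2 \<Longrightarrow> (2 * a - 1) # u \<in> cube (Suc m)"
      using t by (auto simp: Cons_in_cube)
    then show "juxtapose H K (t @ [0]) = juxtapose f g t" "juxtapose H K (t @ [1]) = juxtapose f' g' t"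
      using H(3,4)[of "2 * a # u"] K(3,4)[of "(2 * a - 1) # u"] unfolding t(1) snoc
      by (simp_all add: juxtapose_Cons)
  next
    fix t :: "'r list" and s :: 'r
    assume t: "t \<in> cube_boundary (Suc m)" and s: "0 \<le> s" "s \<le> 1"
    then obtain a u where au: "t = a # u" "u \<in> cube m" "0 \<le> a" "a \<le> 1"
      using cube_boundary_subset by (blast elim: cube_ConsE)
    then have "a \<le> 1/2 \<Longrightarrow> 2 * a # u \<in> cube_boundary (Suc m)"
        "\<not> a \<le> 1/2 \<Longrightarrow> (2 * a - 1) # u \<in> cube_boundary (Suc m)"
      using t by (auto simp: cube_boundary_Cons Cons_in_cube)
    then show "juxtapose H K (t @ [s]) = juxtapose f g t"
      using H(2)[of "2 * a # u" s] K(2)[of "(2 * a - 1) # u" s] s abs_maps_boundary[OF fg t]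
      unfolding au(1) snoc by simp
  qed
qed

end


section \<open>Quotients\<close>

lemma equiv_pullback:
  assumes S: "equiv B S" and R: "\<And>f g. (f, g) \<in> R \<longleftrightarrow> f \<in> A \<and> g \<in> A \<and> (P f, P g) \<in> S"
    and PA: "P ` A \<subseteq> B"
  shows "equiv A R"
proof (rule equivI)
  show "R \<subseteq> A \<times> A" using R by auto
  show "refl_on A R" using S PA R unfolding equiv_def refl_on_def by blast
  show "sym R" using S R by (auto intro!: symI elim!: equivE dest: symD)
  show "trans R" using S R unfolding equiv_def by (auto intro!: transI dest: transD)
qed

text \<open>All representatives of a class have their images in one class, so the union over the
  class collapses; for the induced map this is well-definedness.\<close>

lemma pullback_class_image:
  assumes S: "equiv B S" and R: "\<And>f g. (f, g) \<in> R \<longleftrightarrow> f \<in> A \<and> g \<in> A \<and> (P f, P g) \<in> S"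
    and PA: "P ` A \<subseteq> B" and f: "f \<in> A"
  shows "(\<Union>g\<in>R `` {f}. S `` {P g}) = S `` {P f}"
proof -
  have "S `` {P g} = S `` {P f}" if "g \<in> R `` {f}" for g
    using equiv_class_eq[OF S, of "P f" "P g"] R that by auto
  moreover have "f \<in> R `` {f}" using equiv_class_self[OF equiv_pullback[OF S R PA] f] .
  ultimately show ?thesis by blast
qed

text \<open>The two directions of the pullback description give well-definedness and injectivity;
  for surjectivity it suffices to hit every element up to \<open>S\<close>.\<close>

lemma bij_betw_pullback_quotient:
  assumes S: "equiv B S" and R: "\<And>f g. (f, g) \<in> R \<longleftrightarrow> f \<in> A \<and> g \<in> A \<and> (P f, P g) \<in> S"
    and PA: "P ` A \<subseteq> B" and surj: "\<And>g. g \<in> B \<Longrightarrow> \<exists>f\<in>A. (P f, g) \<in> S"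
  shows "bij_betw (\<lambda>X. \<Union>f\<in>X. S `` {P f}) (A // R) (B // S)"
proof -
  note img = pullback_class_image[OF S R PA]
  note R_eq = equiv_pullback[OF S R PA]
  show ?thesis
  proof (rule bij_betw_imageI)
    show "inj_on (\<lambda>X. \<Union>f\<in>X. S `` {P f}) (A // R)"
    proof (rule inj_onI)
      fix X Y assume "X \<in> A // R" "Y \<in> A // R"
      then obtain f g where fg: "f \<in> A" "X = R `` {f}" "g \<in> A" "Y = R `` {g}"
        by (auto elim!: quotientE)
      assume "(\<Union>f\<in>X. S `` {P f}) = (\<Union>f\<in>Y. S `` {P f})"
      then have "S `` {P f} = S `` {P g}" using fg img by simp
      then have "(P f, P g) \<in> S" using eq_equiv_class[OF _ S] fg PA by blast
      then show "X = Y" using R fg equiv_class_eq[OF R_eq] by simp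
    qed
    show "(\<lambda>X. \<Union>f\<in>X. S `` {P f}) ` (A // R) = B // S"
    proof (intro subset_antisym subsetI)
      fix Y assume "Y \<in> (\<lambda>X. \<Union>f\<in>X. S `` {P f}) ` (A // R)"
      then obtain f where "f \<in> A" "Y = S `` {P f}" using img by (auto elim!: quotientE)
      then show "Y \<in> B // S" using PA by (auto intro: quotientI)
    next
      fix Y assume "Y \<in> B // S"
      then obtain g where g: "g \<in> B" "Y = S `` {g}" by (auto elim!: quotientE)
      then obtain f where f: "f \<in> A" "(P f, g) \<in> S" using surj by blast
      then have "Y = (\<Union>h\<in>R `` {f}. S `` {P h})"
        using g(2) img[OF f(1)] equiv_class_eq[OF S f(2)] by simp
      then show "Y \<in> (\<lambda>X. \<Union>f\<in>X. S `` {P f}) ` (A // R)" using f(1) by (auto intro: quotientI)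
    qed
  qed
qed

text \<open>Multiplication is a union over all pairs of representatives; the congruence property
  makes it a single class.\<close>

lemma class_mult_eq:
  assumes R: "equiv A R" and "f \<in> A" "g \<in> A"
    and jux: "\<And>f f' g g'. (f, f') \<in> R \<Longrightarrow> (g, g') \<in> R \<Longrightarrow> (juxtapose f g, juxtapose f' g') \<in> R"
  shows "class_mult R (R `` {f}) (R `` {g}) = R `` {juxtapose f g}"
proof -
  have "R `` {juxtapose f' g'} = R `` {juxtapose f g}" if "f' \<in> R `` {f}" "g' \<in> R `` {g}" for f' g'
    using equiv_class_eq[OF R jux] that by blast
  moreover have "f \<in> R `` {f}" "g \<in> R `` {g}" using equiv_class_self[OF R] assms(2,3) by blast+
  ultimately show ?thesis unfolding class_mult_def by blast
qed


section \<open>Relative homotopy sets of a Serre fibration\<close>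

context ominimal_expansion
begin

lemma ld_map_points:
  assumes "locally_definable_space D N" "ld_map D (def_space m X) N f" "x \<in> X"
  shows "f x \<in> points N"
proof -
  obtain C where "C \<subseteq> N" "f ` X \<subseteq> points C" using ld_map_finite_charts[OF assms(1,2)] by blast
  then show ?thesis using assms(3) unfolding points_def by blast
qed

lemma rel_maps_iff:
  assumes "1 \<le> n"
  shows "f \<in> rel_maps D n X A x0 \<longleftrightarrow> ld_map D (def_space n (cube n)) X f \<and>
    (\<forall>t\<in>cube_face n. f t \<in> A) \<and> (\<forall>t\<in>cube_box (n - 1) n. f t = x0)"
  unfolding rel_maps_def cube_J_eq[OF assms] by auto

lemma cube_boundary_eq: "1 \<le> n \<Longrightarrow> cube_boundary n = cube_face n \<union> cube_box (n - 1) n"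
  unfolding cube_boundary_def cube_face_def cube_box_def
  by (auto intro: exI[of _ "n - 1"])

text \<open>For \<open>n \<ge> 2\<close> the first coordinate differs from the distinguished last
  one, so its two faces belong to the box: \<open>f\<close> and \<open>g\<close> are both
  \<open>x0\<close> where they are joined.\<close>

lemma juxtapose_rel_maps:
  assumes X: "locally_definable_space D X" and n: "2 \<le> n"
    and f: "f \<in> rel_maps D n X A x0" and g: "g \<in> rel_maps D n X A x0"
  shows "juxtapose f g \<in> rel_maps D n X A x0"
proof -
  obtain m where m: "n = Suc (Suc m)" using le_Suc_ex[OF n] by auto
  \<comment> \<open>Entry \<open>m\<close> of the tail \<open>u\<close> is the last coordinate of
    the cube, the one whose face 0 is free.\<close>
  have box: "a # u \<in> cube_box (n - 1) n \<longleftrightarrow> a # u \<in> cube n \<and>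
      (a = 0 \<or> a = 1 \<or> u ! m = 1 \<or> (\<exists>i<m. u ! i = 0 \<or> u ! i = 1))" for a :: 'r and u
  proof -
    have "(\<exists>i<Suc (Suc m). i \<noteq> Suc m \<and> Q i) \<longleftrightarrow> Q 0 \<or> (\<exists>i<m. Q (Suc i))" for Q
    proof
      assume "\<exists>i<Suc (Suc m). i \<noteq> Suc m \<and> Q i"
      then obtain i where "i < Suc m" "Q i" by (auto simp: less_Suc_eq)
      then show "Q 0 \<or> (\<exists>i<m. Q (Suc i))" by (cases i) auto
    next
      assume "Q 0 \<or> (\<exists>i<m. Q (Suc i))"
      then obtain i where "i < Suc m" "Q i" by (metis Suc_less_eq zero_less_Suc)
      then show "\<exists>i<Suc (Suc m). i \<noteq> Suc m \<and> Q i" by (intro exI[of _ i]) simp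
    qed
    then show ?thesis by (auto simp: cube_box_def m)
  qed
  have face: "a # u \<in> cube_face n \<longleftrightarrow> a # u \<in> cube n \<and> u ! m = 0" for a :: 'r and u
    by (simp add: cube_face_def m)
  have f': "ld_map D (def_space n (cube n)) X f" "\<And>t. t \<in> cube_face n \<Longrightarrow> f t \<in> A"
      "\<And>t. t \<in> cube_box (n - 1) n \<Longrightarrow> f t = x0"
    using f rel_maps_iff[of n f X A x0] n by auto
  have g': "ld_map D (def_space n (cube n)) X g" "\<And>t. t \<in> cube_face n \<Longrightarrow> g t \<in> A"
      "\<And>t. t \<in> cube_box (n - 1) n \<Longrightarrow> g t = x0"
    using g rel_maps_iff[of n g X A x0] n by auto
  have "f (1 # u) = g (0 # u)" if "u \<in> cube (Suc m)" for u
  proof -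
    have "1 # u \<in> cube_box (n - 1) n" "0 # u \<in> cube_box (n - 1) n"
      using that unfolding box by (simp_all add: m Cons_in_cube)
    then show ?thesis using f'(3) g'(3) by simp
  qed
  then have "ld_map D (def_space n (cube n)) X (juxtapose f g)"
    using f'(1) g'(1) unfolding m by (intro ld_map_juxtapose X)
  moreover have "juxtapose f g t \<in> A" if t: "t \<in> cube_face n" for t
  proof -
    have "t \<in> cube (Suc (Suc m))" using t by (simp add: cube_face_def m)
    then obtain a u where au: "t = a # u" "u \<in> cube (Suc m)" "0 \<le> a" "a \<le> 1" by (rule cube_ConsE)
    then have "a \<le> 1/2 \<Longrightarrow> 2 * a # u \<in> cube_face n" "\<not> a \<le> 1/2 \<Longrightarrow> (2 * a - 1) # u \<in> cube_face n"
      using t unfolding au(1) face by (auto simp: m Cons_in_cube)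
    then show ?thesis using f'(2) g'(2) au(1) by (simp add: juxtapose_Cons)
  qed
  moreover have "juxtapose f g t = x0" if t: "t \<in> cube_box (n - 1) n" for t
  proof -
    have "t \<in> cube (Suc (Suc m))" using t by (simp add: cube_box_def m)
    then obtain a u where au: "t = a # u" "u \<in> cube (Suc m)" "0 \<le> a" "a \<le> 1" by (rule cube_ConsE)
    then have "a \<le> 1/2 \<Longrightarrow> 2 * a # u \<in> cube_box (n - 1) n"
        "\<not> a \<le> 1/2 \<Longrightarrow> (2 * a - 1) # u \<in> cube_box (n - 1) n"
      using t unfolding au(1) box by (auto simp: m Cons_in_cube)
    then show ?thesis using f'(3) g'(3) au(1) by (simp add: juxtapose_Cons)
  qed
  ultimately show ?thesis using n by (simp add: rel_maps_iff)
qed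

end

locale pointed_serre_fibration = ominimal_expansion D
  for D :: "nat \<Rightarrow> 'r::real_closed_field list set set" +
  fixes E :: "('e, 'r) chart set" and B :: "('b, 'r) chart set"
    and p :: "'e \<Rightarrow> 'b" and b0 :: 'b and e0 :: 'e and F :: "'e set"
  assumes E: "locally_definable_space D E" and B: "locally_definable_space D B"
    and p: "serre_fibration D E B p"
    and F: "F = {x \<in> points E. p x = b0}" and e0: "e0 \<in> F"
begin

lemma ld_map_p: "ld_map D E B p"
  using p unfolding serre_fibration_def by blast

text \<open>The boundary is the free face together with the box, and \<open>p\<close> sends both
  \<open>F\<close> and \<open>e0\<close> to \<open>b0\<close>.\<close>

lemma rel_maps_boundary:
  assumes "1 \<le> n" "f \<in> rel_maps D n E F e0" "t \<in> cube_boundary n"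
  shows "p (f t) = b0"
  using assms e0 F by (auto simp: cube_boundary_eq rel_maps_iff)

lemma comp_rel_maps:
  assumes "1 \<le> n" "f \<in> rel_maps D n E F e0"
  shows "p \<circ> f \<in> abs_maps D n B b0"
proof -
  have "ld_map D (def_space n (cube n)) B (\<lambda>t. p (f t))"
    using assms by (intro ld_map_post_comp[OF E B ld_map_p _ definable_cube]) (simp add: rel_maps_iff)
  then show ?thesis using rel_maps_boundary[OF assms] by (auto simp: abs_maps_def comp_def)
qed

lemma abs_map_lift:
  assumes n: "1 \<le> n" and g: "g \<in> abs_maps D n B b0"
  shows "\<exists>f\<in>rel_maps D n E F e0. (p \<circ> f, g) \<in> abs_homotopic D n B b0"
proof -
  have k: "n - 1 < n" using n by simp
  have "ld_map D (def_space n (cube_box (n - 1) n)) E (\<lambda>_. e0)"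
    using closed_definable_cube_box[OF k] e0 F
    by (intro ld_map_const E) (auto simp: closed_definable_def)
  moreover have "ld_map D (def_space n (cube n)) B g" using g by (simp add: abs_maps_def)
  moreover have "p e0 = g z" if "z \<in> cube_box (n - 1) n" for z
    using abs_maps_boundary[OF g] cube_box_subset_boundary[OF k] that e0 F by auto
  ultimately obtain f where f: "ld_map D (def_space n (cube n)) E f"
      "\<And>z. z \<in> cube n \<Longrightarrow> p (f z) = g z" "\<And>z. z \<in> cube_box (n - 1) n \<Longrightarrow> f z = e0"
    using serre_fibration_box_lift[OF E B p k] by blast
  \<comment> \<open>The lift is not prescribed on the free face, but \<open>g\<close> is
    \<open>b0\<close> there, so the lift lands in the fibre.\<close>
  have "f t \<in> F" if t: "t \<in> cube_face n" for t
  proof -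
    have "t \<in> cube n" "t \<in> cube_boundary n" using t n cube_boundary_eq by (auto simp: cube_face_def)
    then show ?thesis
      using f(2) abs_maps_boundary[OF g] ld_map_points[OF E f(1)] by (simp add: F)
  qed
  then have fr: "f \<in> rel_maps D n E F e0" using f(1,3) by (simp add: rel_maps_iff[OF n])
  \<comment> \<open>The two maps agree on the cube but possibly not outside it, hence homotopy
    instead of equality.\<close>
  moreover have "(p \<circ> f, g) \<in> abs_homotopic D n B b0"
    using f(2) by (intro abs_homotopic_cong[OF B comp_rel_maps[OF n fr]]) simp
  ultimately show ?thesis by blast
qed

text \<open>During the homotopy the free face may move inside \<open>F\<close>; since
  \<open>p\<close> collapses \<open>F\<close> to \<open>b0\<close>, the projected homotopy is
  stationary on the boundary.\<close>

lemma rel_homotopic_comp: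
  assumes n: "1 \<le> n" and "(f, g) \<in> rel_homotopic D n E F e0"
  shows "(p \<circ> f, p \<circ> g) \<in> abs_homotopic D n B b0"
proof -
  obtain H where f: "f \<in> rel_maps D n E F e0" and g: "g \<in> rel_maps D n E F e0"
    and H: "ld_map D (def_space (Suc n) (cube (Suc n))) E H"
    "\<forall>s\<in>{0..1}. (\<lambda>t. H (t @ [s])) \<in> rel_maps D n E F e0"
    "\<forall>t\<in>cube n. H (t @ [0]) = f t \<and> H (t @ [1]) = g t"
    using assms(2) unfolding rel_homotopic_def times_I_cube by blast
  show ?thesis
  proof (rule abs_homotopicI[OF comp_rel_maps[OF n f] comp_rel_maps[OF n g]])
    show "ld_map D (def_space (Suc n) (cube (Suc n))) B (\<lambda>w. p (H w))"
      by (rule ld_map_post_comp[OF E B ld_map_p H(1) definable_cube])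
    fix t :: "'r list" and s :: 'r
    assume t: "t \<in> cube_boundary n" and "0 \<le> s" "s \<le> 1"
    then have "(\<lambda>t. H (t @ [s])) \<in> rel_maps D n E F e0" using H(2) by simp
    from rel_maps_boundary[OF n this t] rel_maps_boundary[OF n f t]
    show "p (H (t @ [s])) = (p \<circ> f) t" by simp
  qed (use H(3) in auto)
qed

text \<open>The two ends of the homotopy in \<open>B\<close> are lifted by \<open>f\<close> and \<open>g\<close>, and \<open>J\<^sup>n\<^sup>-\<^sup>1 \<times> I\<close> is lifted to
  \<open>e\<^sub>0\<close>; together these faces form a box, whose free face is \<open>I\<^sup>n\<^sup>-\<^sup>1 \<times> I\<close>.\<close>

lemma rel_homotopic_lift:
  assumes n: "1 \<le> n" and f: "f \<in> rel_maps D n E F e0" and g: "g \<in> rel_maps D n E F e0"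
    and pfg: "(p \<circ> f, p \<circ> g) \<in> abs_homotopic D n B b0"
  shows "(f, g) \<in> rel_homotopic D n E F e0"
proof -
  obtain G where G: "ld_map D (def_space (Suc n) (cube (Suc n))) B G"
    "\<And>t s. t \<in> cube_boundary n \<Longrightarrow> 0 \<le> s \<Longrightarrow> s \<le> 1 \<Longrightarrow> G (t @ [s]) = b0"
    "\<And>t. t \<in> cube n \<Longrightarrow> G (t @ [0]) = p (f t)" "\<And>t. t \<in> cube n \<Longrightarrow> G (t @ [1]) = p (g t)"
    using pfg by (elim abs_homotopicE) auto
  \<comment> \<open>The last direction of the cube is the last but one of the cylinder, and remains
    the free one there.\<close>
  define k where "k = n - 1"
  have k: "k < n" "k < Suc n" using n by (auto simp: k_def)
  have fg: "ld_map D (def_space n (cube n)) E f" "ld_map D (def_space n (cube n)) E g"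
      "\<And>t. t \<in> cube_box k n \<Longrightarrow> f t = e0" "\<And>t. t \<in> cube_box k n \<Longrightarrow> g t = e0"
    using f[unfolded rel_maps_iff[OF n]] g[unfolded rel_maps_iff[OF n]] by (auto simp: k_def)
  have snoc_box: "t @ [s] \<in> cube_box k (Suc n) \<longleftrightarrow>
      t \<in> cube n \<and> 0 \<le> s \<and> s \<le> 1 \<and> (s = 0 \<or> s = 1 \<or> t \<in> cube_box k n)" for t :: "'r list" and s
  proof (cases "t \<in> cube n")
    case True
    have "(t @ [s]) ! n = s" "\<And>i. i < n \<Longrightarrow> (t @ [s]) ! i = t ! i"
      using cube_length[OF True] by (simp_all add: nth_append)
    then show ?thesis using True k by (auto simp: cube_box_def snoc_in_cube Ex_less_Suc)
  qed (simp add: cube_box_def snoc_in_cube)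
  \<comment> \<open>The lift to be extended. Its three pieces agree on overlaps because
    \<open>f\<close> and \<open>g\<close> are \<open>e0\<close> on the box of the cube.\<close>
  define h where "h w = (if w ! n = 0 then f (butlast w) else if w ! n = 1 then g (butlast w) else e0)"
    for w
  have h_snoc: "h (t @ [s]) = (if s = 0 then f t else if s = 1 then g t else e0)"
    if "t \<in> cube n" for t s
    using cube_length[OF that] by (simp add: h_def nth_append)
  let ?C = "cube (Suc n) :: 'r list set"
  \<comment> \<open>Bottom, top and side walls of the cylinder. In \<open>?Z\<close> the index
    \<open>n\<close> is absent, since its faces are \<open>?X\<close> and \<open>?Y\<close>, and
    \<open>k\<close> enters with its face 1 only.\<close>
  let ?X = "?C \<inter> {x \<in> Rn (Suc n). x ! n = 0}" and ?Y = "?C \<inter> {x \<in> Rn (Suc n). x ! n = 1}"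
    and ?Z = "?C \<inter> ({x \<in> Rn (Suc n). x ! k = 1} \<union>
      (\<Union>i\<in>{..<n} - {k}. {x \<in> Rn (Suc n). x ! i = 0} \<union> {x \<in> Rn (Suc n). x ! i = 1}))"
  have X: "closed_definable (Suc n) ?X" and Y: "closed_definable (Suc n) ?Y"
    by (intro closed_definable_Int closed_definable_cube closed_definable_eq pl_intros; simp)+
  have Z: "closed_definable (Suc n) ?Z"
    using k by (intro closed_definable_Int closed_definable_Un closed_definable_UN closed_definable_eq
        closed_definable_cube pl_intros) auto
  have butlast_Z: "butlast w \<in> cube_box k n" if w: "w \<in> ?Z" for w
  proof -
    have "w \<in> cube (Suc n)" using w by blast
    then obtain t s where ts: "w = t @ [s]" "t \<in> cube n" by (rule cube_SucE)
    then show ?thesis using w k by (auto simp: cube_box_def cube_length nth_append)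
  qed
  have butlast_cube: "butlast ` S \<subseteq> cube n" if "S \<subseteq> cube (Suc n)" for S :: "'r list set"
    using that by (auto elim!: cube_SucE dest!: subsetD)
  have "ld_map D (def_space (Suc n) (?X \<union> (?Y \<union> ?Z))) E h"
  proof (rule ld_map_glue[OF E X closed_definable_Un[OF Y Z]])
    show "ld_map D (def_space (Suc n) ?X) E (\<lambda>w. f (butlast w))"
      using X by (intro ld_map_pl_comp[OF E fg(1) pl_map_butlast] butlast_cube)
        (auto simp: closed_definable_def)
    show "ld_map D (def_space (Suc n) (?Y \<union> ?Z)) E (\<lambda>w. if w ! n = 1 then g (butlast w) else e0)"
    proof (rule ld_map_glue[OF E Y Z])
      show "ld_map D (def_space (Suc n) ?Y) E (\<lambda>w. g (butlast w))"
        using Y by (intro ld_map_pl_comp[OF E fg(2) pl_map_butlast] butlast_cube)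
          (auto simp: closed_definable_def)
      show "ld_map D (def_space (Suc n) ?Z) E (\<lambda>_. e0)"
        using Z e0 F by (intro ld_map_const E) (auto simp: closed_definable_def)
      show "(if w ! n = 1 then g (butlast w) else e0) = e0" if "w \<in> ?Z" for w
        using fg(4)[OF butlast_Z[OF that]] by simp
    qed simp
    show "h w = (if w ! n = 1 then g (butlast w) else e0)" if "w \<in> ?Y \<union> ?Z" for w
    \<comment> \<open>At time 0 the point cannot lie in \<open>?Y\<close>, so it lies in
      \<open>?Z\<close>, where \<open>f\<close> is already \<open>e0\<close>.\<close>
    proof (cases "w ! n = 0")
      case True
      then have "w \<in> ?Z" using that by auto
      then show ?thesis using fg(3)[OF butlast_Z] True by (simp add: h_def)
    qed (simp add: h_def)
  qed (simp add: h_def)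
  moreover have "?X \<union> (?Y \<union> ?Z) = cube_box k (Suc n)"
    using k by (auto simp: cube_box_def cube_length less_Suc_eq)
  ultimately have h: "ld_map D (def_space (Suc n) (cube_box k (Suc n))) E h" by simp
  have ph: "p (h w) = G w" if w: "w \<in> cube_box k (Suc n)" for w
  proof -
    have "w \<in> cube (Suc n)" using w by (simp add: cube_box_def)
    then obtain t s where ts: "w = t @ [s]" "t \<in> cube n" "0 \<le> s" "s \<le> 1" by (rule cube_SucE)
    show ?thesis
    proof (cases "s = 0 \<or> s = 1")
      case True
      then show ?thesis using ts h_snoc G(3,4) by auto
    next
      case False
      then have "t \<in> cube_boundary n"
        using w cube_box_subset_boundary[OF k(1)] unfolding ts(1) snoc_box by blast
      then show ?thesis using False ts h_snoc G(2) e0 F by simp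
    qed
  qed
  obtain H where H: "ld_map D (def_space (Suc n) (cube (Suc n))) E H"
      "\<And>w. w \<in> cube (Suc n) \<Longrightarrow> p (H w) = G w" "\<And>w. w \<in> cube_box k (Suc n) \<Longrightarrow> H w = h w"
    using serre_fibration_box_lift[OF E B p k(2) h G(1) ph] by blast
  have "(\<lambda>t. H (t @ [s])) \<in> rel_maps D n E F e0" if s: "0 \<le> s" "s \<le> 1" for s
    unfolding rel_maps_iff[OF n]
  proof (intro conjI ballI)
    show "ld_map D (def_space n (cube n)) E (\<lambda>t. H (t @ [s]))"
      using s by (intro ld_map_pl_comp[OF E H(1) pl_map_snoc[OF pl_map_id pl_const]] definable_cube)
        (auto simp: snoc_in_cube)
    \<comment> \<open>The free face of the cylinder: \<open>G\<close> is \<open>b0\<close> there, so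
      the lift stays in \<open>F\<close> at all times.\<close>
    fix t :: "'r list" assume t: "t \<in> cube_face n"
    then have "t \<in> cube n" "t \<in> cube_boundary n" using n cube_boundary_eq by (auto simp: cube_face_def)
    then have "t @ [s] \<in> cube (Suc n)" "p (H (t @ [s])) = b0"
      using H(2) G(2) s by (simp_all add: snoc_in_cube)
    then show "H (t @ [s]) \<in> F" using ld_map_points[OF E H(1)] by (simp add: F)
  next
    fix t :: "'r list" assume "t \<in> cube_box (n - 1) n"
    then have t: "t \<in> cube_box k n" "t \<in> cube n" by (auto simp: k_def cube_box_def)
    then have "H (t @ [s]) = h (t @ [s])" using s by (intro H(3)) (simp add: snoc_box)
    then show "H (t @ [s]) = e0" using h_snoc[OF t(2)] fg(3,4)[OF t(1)] by simp
  qed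
  moreover have "H (t @ [0]) = f t" "H (t @ [1]) = g t" if "t \<in> cube n" for t
    using H(3) that h_snoc[OF that] by (simp_all add: snoc_box)
  ultimately show ?thesis
    using f g H(1) unfolding rel_homotopic_def times_I_cube by auto
qed

lemma rel_homotopic_iff:
  assumes "1 \<le> n"
  shows "(f, g) \<in> rel_homotopic D n E F e0 \<longleftrightarrow>
    f \<in> rel_maps D n E F e0 \<and> g \<in> rel_maps D n E F e0 \<and> (p \<circ> f, p \<circ> g) \<in> abs_homotopic D n B b0"
  using rel_homotopic_comp[OF assms] rel_homotopic_lift[OF assms]
  by (auto simp: rel_homotopic_def)

section \<open>Passage to homotopy classes: bijectivity and multiplicativity\<close>

lemma bij_betw_induced_map:
  assumes n: "1 \<le> n"
  shows "bij_betw (induced_map D n B b0 p) (carrier (rel_pi D n E F e0)) (carrier (abs_pi D n B b0))"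
proof -
  have "bij_betw (\<lambda>X. \<Union>f\<in>X. abs_homotopic D n B b0 `` {p \<circ> f})
      (rel_maps D n E F e0 // rel_homotopic D n E F e0) (abs_maps D n B b0 // abs_homotopic D n B b0)"
    using comp_rel_maps[OF n] abs_map_lift[OF n]
    by (intro bij_betw_pullback_quotient[OF equiv_abs_homotopic[OF B] rel_homotopic_iff[OF n]]) blast+
  moreover have "induced_map D n B b0 p = (\<lambda>X. \<Union>f\<in>X. abs_homotopic D n B b0 `` {p \<circ> f})"
    by (simp add: fun_eq_iff induced_map_def)
  ultimately show ?thesis by (simp add: rel_pi_def abs_pi_def)
qed

text \<open>Composition with \<open>p\<close> commutes with \<open>juxtapose\<close> as an equality
  of functions, so multiplicativity holds for representatives and only independence of their choice
  is left.\<close>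

lemma induced_map_hom:
  assumes n: "2 \<le> n"
  shows "induced_map D n B b0 p \<in> hom (rel_pi D n E F e0) (abs_pi D n B b0)"
proof -
  let ?R = "rel_homotopic D n E F e0" and ?S = "abs_homotopic D n B b0"
  obtain m where m: "n = Suc m" using n by (cases n) auto
  have n1: "1 \<le> n" using n by simp
  have PA: "(\<circ>) p ` rel_maps D n E F e0 \<subseteq> abs_maps D n B b0" using comp_rel_maps[OF n1] by blast
  note S = equiv_abs_homotopic[OF B, of n b0]
  note R = equiv_pullback[OF S rel_homotopic_iff[OF n1] PA]
  have jux_S: "(juxtapose f g, juxtapose f' g') \<in> ?S" if "(f, f') \<in> ?S" "(g, g') \<in> ?S" for f f' g g'
    using that unfolding m by (rule juxtapose_abs_homotopic[OF B])
  \<comment> \<open>Settled in \<open>B\<close>: the juxtapositions are relative maps, and their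
    composites with \<open>p\<close> are homotopic by \<open>jux_S\<close>.\<close>
  have jux_R: "(juxtapose f g, juxtapose f' g') \<in> ?R" if "(f, f') \<in> ?R" "(g, g') \<in> ?R" for f f' g g'
    using that jux_S juxtapose_rel_maps[OF E n]
    unfolding rel_homotopic_iff[OF n1] comp_juxtapose by blast
  have img: "induced_map D n B b0 p (?R `` {f}) = ?S `` {p \<circ> f}" if "f \<in> rel_maps D n E F e0" for f
    unfolding induced_map_def
    by (rule pullback_class_image[OF S rel_homotopic_iff[OF n1] PA that])
  show ?thesis
  proof (rule homI)
    fix X assume "X \<in> carrier (rel_pi D n E F e0)"
    then show "induced_map D n B b0 p X \<in> carrier (abs_pi D n B b0)"
      using bij_betw_imp_surj_on[OF bij_betw_induced_map[OF n1]] by blast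
  next
    fix X Y assume "X \<in> carrier (rel_pi D n E F e0)" "Y \<in> carrier (rel_pi D n E F e0)"
    then obtain f g where f: "f \<in> rel_maps D n E F e0" "X = ?R `` {f}"
        and g: "g \<in> rel_maps D n E F e0" "Y = ?R `` {g}"
      by (auto simp: rel_pi_def elim!: quotientE)
    have "class_mult ?R X Y = ?R `` {juxtapose f g}"
      unfolding f(2) g(2) by (rule class_mult_eq[OF R f(1) g(1)]) (rule jux_R)
    then have "induced_map D n B b0 p (class_mult ?R X Y) = ?S `` {p \<circ> juxtapose f g}"
      using img[OF juxtapose_rel_maps[OF E n f(1) g(1)]] by simp
    also have "\<dots> = class_mult ?S (?S `` {p \<circ> f}) (?S `` {p \<circ> g})"
      unfolding comp_juxtapose
      by (rule class_mult_eq[OF S comp_rel_maps[OF n1 f(1)] comp_rel_maps[OF n1 g(1)], symmetric])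
        (rule jux_S)
    finally show "induced_map D n B b0 p (X \<otimes>\<^bsub>rel_pi D n E F e0\<^esub> Y) =
        induced_map D n B b0 p X \<otimes>\<^bsub>abs_pi D n B b0\<^esub> induced_map D n B b0 p Y"
      using img f g by (simp add: rel_pi_def abs_pi_def)
  qed
qed
end

theorem theorem6p10:
  fixes D :: "nat \<Rightarrow> 'r::real_closed_field list set set"
    and E :: "('e, 'r) chart set" and B :: "('b, 'r) chart set"
    and p :: "'e \<Rightarrow> 'b" and b0 :: 'b and e0 :: 'e and F :: "'e set"
  assumes "ominimal_expansion D"
    and "LD_space D B" and "LD_space D E"
    and "serre_fibration D E B p"
    and "b0 \<in> points B" and "F = {x \<in> points E. p x = b0}" and "e0 \<in> F"
  shows "bij_betw (induced_map D 1 B b0 p)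
           (carrier (rel_pi D 1 E F e0)) (carrier (abs_pi D 1 B b0)) \<and>
         (\<forall>n\<ge>2. induced_map D n B b0 p \<in> iso (rel_pi D n E F e0) (abs_pi D n B b0))"
proof -
  interpret pointed_serre_fibration D E B p b0 e0 F
    using assms
    by (simp add: pointed_serre_fibration_def pointed_serre_fibration_axioms_def
        LD_space_def ld_space_def)
  show ?thesis
    using bij_betw_induced_map induced_map_hom by (simp add: iso_def)
qed

end
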